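(* Let $M^n$ be a closed topological $n$-manifold, $n\geq 2$, and let $f_1,f_2\in SRH(M^n)$, each having a non-empty set of saddle periodic points. Then $f_1$, $f_2$ are conjugate if and only if one of the following conditions holds: (i) the sets $A(f_1)$, $A(f_2)$ have the same dynamical embedding; (ii) the sets $R(f_1)$, $R(f_2)$ have the same dynamical embedding.
   Context: Conjugacy: homeomorphisms $f_1,f_2:M^n\to M^n$ are conjugate if there is a homeomorphism $h:M^n\to M^n$ with $h\circ f_1=f_2\circ h$. $NW(f)$ denotes the non-wandering set and $clos$ the topological closure. Same dynamical embedding: let $f_1:M_1\to M_1$, $f_2:M_2\to M_2$ be homeomorphisms of $n$-manifolds (possibly $M_1=M_2$) and let $N_1,N_2$ be invariant sets, $f_i(N_i)=N_i$. The sets $N_1,N_2$ have the same dynamical embedding if there are neighborhoods $\delta_1,\delta_2$ of $clos\,N_1$, $clos\,N_2$ respectively and a homeomorphism (onto its image) $h_0:\delta_1\cup f_1(\delta_1)\to M_2$ such that $h_0(\delta_1)=\delta_2$, $h_0(clos\,N_1)=clos\,N_2$, and $h_0\circ f_1|_{\delta_1}=f_2\circ h_0|_{\delta_1}$. A-diffeomorphism: a diffeomorphism $F:L^n\to L^n$ of a smooth manifold whose non-wandering set $NW(F)$ is hyperbolic and in which periodic orbits are dense. Then $NW(F)$ is a finite disjoint union of closed $F$-invariant sets (basic sets) on each of which $F$ is topologically transitive. Smale A-homeomorphism: a homeomorphism $f:M^n\to M^n$ for which there is an A-diffeomorphism $F:L^n\to L^n$ of a smooth $n$-manifold such that $NW(f)$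 and $NW(F)$ have the same dynamical embedding. Consequently $NW(f)$ is a finite union of pairwise disjoint closed $f$-invariant sets (the basic sets of $f$, corresponding to those of $F$) on each of which $f$ is topologically transitive. A basic set is trivial if it is an isolated periodic orbit. For a basic set $\Lambda$, $W^{s}(\Lambda)=\bigcup_{x\in\Lambda}W^{s}(x)$ and $W^{u}(\Lambda)=\bigcup_{x\in\Lambda}W^{u}(x)$, where $W^s(x)$ (resp. $W^u(x)$) is the set of points $y$ with $\varrho(f^k x,f^k y)\to 0$ as $k\to+\infty$ (resp. $k\to-\infty$), $\varrho$ a metric on the manifold. A basic set $\Lambda$ is a sink basic set if $W^u(\Lambda)=\Lambda$, a source basic set if $W^s(\Lambda)=\Lambda$, and a saddle basic set if it is neither. The families of sink, source and saddle basic sets are denoted $\omega(f)$, $\alpha(f)$, $\sigma(f)$ respectively. $f$ is regular if all basic sets in $\omega(f),\sigma(f),\alpha(f)$ are trivial; $SRH(M^n)$ denotes the class of regular Smale A-homeomorphisms $M^n\to M^n$. The sets $A(f)$, $R(f)$ are $$A(f)=\Big(\bigcup_{\Lambda\in\omega(f)}\Lambda\Big)\cup\bigcup_{\nu\in\sigma(f)}W^u(\nu),\qquad R(f)=\Big(\bigcup_{\Lambda\in\alpha(f)}\Lambda\Big)\cup\bigcup_{\nu\in\sigma(f)}W^s(\nu).$$ *)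

theory Defs
  imports "HOL-Analysis.Analysis"
begin

section \<open>Manifolds\<close>

definition second_countable_space :: "'a topology \<Rightarrow> bool" where
  "second_countable_space X \<longleftrightarrow>
     (\<exists>\<B>. countable \<B> \<and> (\<forall>V\<in>\<B>. openin X V) \<and>
          (\<forall>U x. openin X U \<and> x \<in> U \<longrightarrow> (\<exists>V\<in>\<B>. x \<in> V \<and> V \<subseteq> U)))"

text \<open>A chart is a pair of its domain and its coordinate map; the values of the map
  outside the domain are irrelevant.\<close>

type_synonym ('a, 'n) chart = "'a set \<times> ('a \<Rightarrow> real^'n)"

definition is_chart :: "'a topology \<Rightarrow> ('a, 'n::finite) chart \<Rightarrow> bool" where
  "is_chart X c \<longleftrightarrow>
     openin X (fst c) \<and> open (snd c ` fst c) \<and>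
     homeomorphic_map (subtopology X (fst c)) (top_of_set (snd c ` fst c)) (snd c)"

text \<open>The dimension is \<open>CARD('n)\<close>; manifolds have no boundary.\<close>

definition topological_manifold :: "'n::finite itself \<Rightarrow> 'a topology \<Rightarrow> bool" where
  "topological_manifold _ X \<longleftrightarrow>
     Hausdorff_space X \<and> second_countable_space X \<and>
     (\<forall>p\<in>topspace X. \<exists>c::('a, 'n) chart. is_chart X c \<and> p \<in> fst c)"

definition closed_manifold :: "'n::finite itself \<Rightarrow> 'a topology \<Rightarrow> bool" where
  "closed_manifold n X \<longleftrightarrow> topological_manifold n X \<and> compact_space X"

definition metric_on :: "'a topology \<Rightarrow> ('a \<Rightarrow> 'a \<Rightarrow> real) \<Rightarrow> bool" where
  "metric_on X d \<longleftrightarrow>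
     Metric_space (topspace X) d \<and> Metric_space.mtopology (topspace X) d = X"

text \<open>\<open>C\<^sup>k\<close> maps on an open set, via iterated directional derivatives.\<close>

primrec Ck_on :: "nat \<Rightarrow> 'e::euclidean_space set \<Rightarrow> ('e \<Rightarrow> 'f::real_normed_vector) \<Rightarrow> bool" where
  "Ck_on 0 S f \<longleftrightarrow> continuous_on S f"
| "Ck_on (Suc k) S f \<longleftrightarrow>
     (\<forall>x\<in>S. f differentiable (at x)) \<and>
     (\<forall>v. Ck_on k S (\<lambda>x. frechet_derivative f (at x) v))"

definition smooth_on :: "'e::euclidean_space set \<Rightarrow> ('e \<Rightarrow> 'f::real_normed_vector) \<Rightarrow> bool" where
  "smooth_on S f \<longleftrightarrow> (\<forall>k. Ck_on k S f)"

definition inv_chart :: "('a, 'n::finite) chart \<Rightarrow> real^'n \<Rightarrow> 'a" where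
  "inv_chart c = inv_into (fst c) (snd c)"

definition local_rep ::
    "('a \<Rightarrow> 'a) \<Rightarrow> ('a, 'n::finite) chart \<Rightarrow> ('a, 'n) chart \<Rightarrow> real^'n \<Rightarrow> real^'n" where
  "local_rep F c c' = snd c' \<circ> F \<circ> inv_chart c"

definition smooth_atlas :: "'a topology \<Rightarrow> ('a, 'n::finite) chart set \<Rightarrow> bool" where
  "smooth_atlas X A \<longleftrightarrow>
     (\<forall>c\<in>A. is_chart X c) \<and> (\<Union>c\<in>A. fst c) = topspace X \<and>
     (\<forall>c\<in>A. \<forall>c'\<in>A. smooth_on (snd c ` (fst c \<inter> fst c')) (local_rep id c c'))"

definition smooth_manifold :: "'a topology \<Rightarrow> ('a, 'n::finite) chart set \<Rightarrow> bool" where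
  "smooth_manifold X A \<longleftrightarrow>
     Hausdorff_space X \<and> second_countable_space X \<and> smooth_atlas X A"

definition smooth_self_map ::
    "'a topology \<Rightarrow> ('a, 'n::finite) chart set \<Rightarrow> ('a \<Rightarrow> 'a) \<Rightarrow> bool" where
  "smooth_self_map X A F \<longleftrightarrow>
     continuous_map X X F \<and>
     (\<forall>c\<in>A. \<forall>c'\<in>A. smooth_on (snd c ` (fst c \<inter> F -` fst c')) (local_rep F c c'))"

definition inv_on :: "'a topology \<Rightarrow> ('a \<Rightarrow> 'a) \<Rightarrow> 'a \<Rightarrow> 'a" where
  "inv_on X f = inv_into (topspace X) f"

definition diffeomorphism ::
    "'a topology \<Rightarrow> ('a, 'n::finite) chart set \<Rightarrow> ('a \<Rightarrow> 'a) \<Rightarrow> bool" where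
  "diffeomorphism X A F \<longleftrightarrow>
     bij_betw F (topspace X) (topspace X) \<and>
     smooth_self_map X A F \<and> smooth_self_map X A (inv_on X F)"

text \<open>The tangent space at every point \<open>p\<close> is identified with \<open>real^'n\<close> by means of the
  coordinates of a chosen chart around \<open>p\<close>; tangent maps, Riemannian metrics and
  splittings are expressed through this identification.\<close>

definition chart_at :: "('a, 'n::finite) chart set \<Rightarrow> 'a \<Rightarrow> ('a, 'n) chart" where
  "chart_at A p = (SOME c. c \<in> A \<and> p \<in> fst c)"

definition tangent_map ::
    "('a, 'n::finite) chart set \<Rightarrow> ('a \<Rightarrow> 'a) \<Rightarrow> 'a \<Rightarrow> real^'n \<Rightarrow> real^'n" where
  "tangent_map A F p =
     frechet_derivative (local_rep F (chart_at A p) (chart_at A (F p)))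
       (at (snd (chart_at A p) p))"

text \<open>The tangent vector at \<open>p\<close> with coordinates \<open>v\<close> in an arbitrary chart \<open>c\<close> around \<open>p\<close>.\<close>

definition tangent_of_coords ::
    "('a, 'n::finite) chart set \<Rightarrow> ('a, 'n) chart \<Rightarrow> 'a \<Rightarrow> real^'n \<Rightarrow> real^'n" where
  "tangent_of_coords A c p =
     frechet_derivative (local_rep id c (chart_at A p)) (at (snd c p))"

definition riemannian_metric ::
    "'a topology \<Rightarrow> ('a, 'n::finite) chart set \<Rightarrow> ('a \<Rightarrow> real^'n \<Rightarrow> real^'n \<Rightarrow> real) \<Rightarrow> bool" where
  "riemannian_metric X A g \<longleftrightarrow>
     (\<forall>p\<in>topspace X. bilinear (g p) \<and> (\<forall>v w. g p v w = g p w v) \<and> (\<forall>v. v \<noteq> 0 \<longrightarrow> g p v v > 0)) \<and>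
     (\<forall>c\<in>A. \<forall>v w. smooth_on (snd c ` fst c)
        (\<lambda>x. let p = inv_chart c x
             in g p (tangent_of_coords A c p v) (tangent_of_coords A c p w)))"

definition tangent_norm ::
    "('a \<Rightarrow> real^'n::finite \<Rightarrow> real^'n \<Rightarrow> real) \<Rightarrow> 'a \<Rightarrow> real^'n \<Rightarrow> real" where
  "tangent_norm g p v = sqrt (g p v v)"

definition hyperbolic_set ::
    "'a topology \<Rightarrow> ('a, 'n::finite) chart set \<Rightarrow> ('a \<Rightarrow> 'a) \<Rightarrow> 'a set \<Rightarrow> bool" where
  "hyperbolic_set X A F K \<longleftrightarrow>
     compactin X K \<and> F ` K = K \<and>
     (\<exists>g Es Eu C \<mu>. riemannian_metric X A g \<and> 0 < C \<and> 0 < \<mu> \<and> \<mu> < 1 \<and>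
       (\<forall>p\<in>K.
          subspace (Es p) \<and> subspace (Eu p) \<and>
          Es p \<inter> Eu p = {0} \<and> {v + w |v w. v \<in> Es p \<and> w \<in> Eu p} = UNIV \<and>
          tangent_map A F p ` Es p = Es (F p) \<and> tangent_map A F p ` Eu p = Eu (F p) \<and>
          (\<forall>k. \<forall>v\<in>Es p. tangent_norm g ((F ^^ k) p) (tangent_map A (F ^^ k) p v)
                          \<le> C * \<mu> ^ k * tangent_norm g p v) \<and>
          (\<forall>k. \<forall>v\<in>Eu p. tangent_norm g ((inv_on X F ^^ k) p) (tangent_map A (inv_on X F ^^ k) p v)
                          \<le> C * \<mu> ^ k * tangent_norm g p v)))"


section \<open>Dynamics of homeomorphisms\<close>

definition conjugate :: "'a topology \<Rightarrow> ('a \<Rightarrow> 'a) \<Rightarrow> ('a \<Rightarrow> 'a) \<Rightarrow> bool" where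
  "conjugate X f1 f2 \<longleftrightarrow>
     (\<exists>h. homeomorphic_map X X h \<and> (\<forall>x\<in>topspace X. h (f1 x) = f2 (h x)))"

definition nonwandering :: "'a topology \<Rightarrow> ('a \<Rightarrow> 'a) \<Rightarrow> 'a set" where
  "nonwandering X f =
     {x \<in> topspace X. \<forall>U. openin X U \<and> x \<in> U \<longrightarrow> (\<exists>k\<ge>1. (f ^^ k) ` U \<inter> U \<noteq> {})}"

definition periodic_point :: "('a \<Rightarrow> 'a) \<Rightarrow> 'a \<Rightarrow> bool" where
  "periodic_point f p \<longleftrightarrow> (\<exists>k\<ge>1. (f ^^ k) p = p)"

text \<open>The full (two-sided) orbit.\<close>

definition orbit_of :: "'a topology \<Rightarrow> ('a \<Rightarrow> 'a) \<Rightarrow> 'a \<Rightarrow> 'a set" where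
  "orbit_of X f x = range (\<lambda>k. (f ^^ k) x) \<union> range (\<lambda>k. (inv_on X f ^^ k) x)"

text \<open>A neighbourhood of a set need not be open.\<close>

definition neighbourhood_of :: "'a topology \<Rightarrow> 'a set \<Rightarrow> 'a set \<Rightarrow> bool" where
  "neighbourhood_of X D S \<longleftrightarrow> D \<subseteq> topspace X \<and> (\<exists>U. openin X U \<and> S \<subseteq> U \<and> U \<subseteq> D)"

definition same_dynamical_embedding ::
    "'a topology \<Rightarrow> ('a \<Rightarrow> 'a) \<Rightarrow> 'a set \<Rightarrow> 'b topology \<Rightarrow> ('b \<Rightarrow> 'b) \<Rightarrow> 'b set \<Rightarrow> bool" where
  "same_dynamical_embedding X f1 N1 Y f2 N2 \<longleftrightarrow>
     N1 \<subseteq> topspace X \<and> N2 \<subseteq> topspace Y \<and> f1 ` N1 = N1 \<and> f2 ` N2 = N2 \<and>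
     (\<exists>D1 D2 h. neighbourhood_of X D1 (X closure_of N1) \<and>
                neighbourhood_of Y D2 (Y closure_of N2) \<and>
                embedding_map (subtopology X (D1 \<union> f1 ` D1)) Y h \<and>
                h ` D1 = D2 \<and> h ` (X closure_of N1) = Y closure_of N2 \<and>
                (\<forall>x\<in>D1. h (f1 x) = f2 (h x)))"

definition A_diffeomorphism ::
    "'a topology \<Rightarrow> ('a, 'n::finite) chart set \<Rightarrow> ('a \<Rightarrow> 'a) \<Rightarrow> bool" where
  "A_diffeomorphism X A F \<longleftrightarrow>
     smooth_manifold X A \<and> diffeomorphism X A F \<and>
     hyperbolic_set X A F (nonwandering X F) \<and>
     nonwandering X F \<subseteq> X closure_of {p \<in> nonwandering X F. periodic_point F p}"

text \<open>A second countable manifold has at most the cardinality of the continuum, so up to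
  diffeomorphism every smooth manifold is carried by a set of reals (with an arbitrary
  topology, unrelated to that of the real line); hence the type of \<open>L\<close> is no restriction.\<close>

definition Smale_A_homeomorphism ::
    "'n::finite itself \<Rightarrow> 'a topology \<Rightarrow> ('a \<Rightarrow> 'a) \<Rightarrow> bool" where
  "Smale_A_homeomorphism _ X f \<longleftrightarrow>
     homeomorphic_map X X f \<and>
     (\<exists>(L :: real topology) (A :: (real, 'n) chart set) F.
        A_diffeomorphism L A F \<and>
        same_dynamical_embedding X f (nonwandering X f) L F (nonwandering L F))"

definition topologically_transitive :: "'a topology \<Rightarrow> ('a \<Rightarrow> 'a) \<Rightarrow> 'a set \<Rightarrow> bool" where
  "topologically_transitive X f S \<longleftrightarrow> (\<exists>x\<in>S. S \<subseteq> X closure_of (orbit_of X f x))"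

definition spectral_decomposition :: "'a topology \<Rightarrow> ('a \<Rightarrow> 'a) \<Rightarrow> 'a set set \<Rightarrow> bool" where
  "spectral_decomposition X f \<B> \<longleftrightarrow>
     finite \<B> \<and> disjoint \<B> \<and> \<Union>\<B> = nonwandering X f \<and>
     (\<forall>\<Lambda>\<in>\<B>. \<Lambda> \<noteq> {} \<and> closedin X \<Lambda> \<and> f ` \<Lambda> = \<Lambda> \<and> topologically_transitive X f \<Lambda>)"

lemma inv_iterate_in:
  assumes "inj_on f (topspace X)" "S \<subseteq> topspace X" "f ` S = S" "x \<in> S"
  shows "(inv_on X f ^^ k) x \<in> S"
proof (induction k)
  case (Suc k)
  then obtain y where "y \<in> S" "(inv_on X f ^^ k) x = f y" using assms(3) by blast
  then show ?case using assms(1,2) by (auto simp: inv_on_def inv_into_f_f)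
qed (simp add: assms)

lemma orbit_of_subset:
  assumes "inj_on f (topspace X)" "S \<subseteq> topspace X" "f ` S = S" "x \<in> S"
  shows "orbit_of X f x \<subseteq> S"
proof -
  have "(f ^^ k) x \<in> S" for k using assms(3,4) by (induction k) auto
  then show ?thesis using inv_iterate_in[OF assms] by (auto simp: orbit_of_def)
qed

text \<open>The decomposition is unique; in particular, it is carried to that of the model
  diffeomorphism by every homeomorphism witnessing the same dynamical embedding of the
  non-wandering sets.\<close>

lemma spectral_decomposition_subset:
  assumes "inj_on f (topspace X)" "spectral_decomposition X f \<B>"
    "spectral_decomposition X f \<C>" "\<Lambda> \<in> \<B>"
  shows "\<Lambda> \<in> \<C>"
proof -
  have sub: "P \<subseteq> Q" if "spectral_decomposition X f \<D>" "spectral_decomposition X f \<E>"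
      "P \<in> \<D>" "Q \<in> \<E>" "x \<in> P" "x \<in> Q" "P \<subseteq> X closure_of (orbit_of X f x)"
    for P Q \<D> \<E> x
  proof -
    have Q: "closedin X Q" "f ` Q = Q" using that by (auto simp: spectral_decomposition_def)
    have "orbit_of X f x \<subseteq> Q"
      by (rule orbit_of_subset[OF assms(1) closedin_subset[OF Q(1)] Q(2) that(6)])
    then have "X closure_of (orbit_of X f x) \<subseteq> Q" using Q(1) by (rule closure_of_minimal)
    with that(7) show ?thesis by (rule subset_trans)
  qed
  obtain x where x: "x \<in> \<Lambda>" "\<Lambda> \<subseteq> X closure_of (orbit_of X f x)"
    using assms(2,4) unfolding spectral_decomposition_def topologically_transitive_def by meson
  have U: "\<Union>\<B> = \<Union>\<C>" using assms(2,3) by (simp add: spectral_decomposition_def)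
  then obtain Q where Q: "Q \<in> \<C>" "x \<in> Q" using x assms(4) by blast
  have LQ: "\<Lambda> \<subseteq> Q" using sub[OF assms(2,3,4) Q(1) x(1) Q(2) x(2)] .
  obtain y where y: "y \<in> Q" "Q \<subseteq> X closure_of (orbit_of X f y)"
    using assms(3) Q(1) unfolding spectral_decomposition_def topologically_transitive_def by meson
  obtain P where P: "P \<in> \<B>" "y \<in> P" using U y Q by blast
  have QP: "Q \<subseteq> P" using sub[OF assms(3,2) Q(1) P(1) y(1) P(2) y(2)] .
  have "disjoint \<B>" using assms(2) by (simp add: spectral_decomposition_def)
  moreover have "x \<in> P \<inter> \<Lambda>" using LQ QP x(1) by blast
  ultimately have "P = \<Lambda>" using disjointD[OF _ P(1) assms(4)] by blast
  then show ?thesis using LQ QP Q(1) by auto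
qed

lemma spectral_decomposition_unique:
  assumes "homeomorphic_map X X f" "spectral_decomposition X f \<B>" "spectral_decomposition X f \<C>"
  shows "\<B> = \<C>"
proof -
  have "inj_on f (topspace X)" using assms(1) by (simp add: homeomorphic_eq_everything_map)
  then show ?thesis using spectral_decomposition_subset assms(2,3) by blast
qed

definition basic_sets :: "'a topology \<Rightarrow> ('a \<Rightarrow> 'a) \<Rightarrow> 'a set set" where
  "basic_sets X f = {\<Lambda>. \<exists>\<B>. spectral_decomposition X f \<B> \<and> \<Lambda> \<in> \<B>}"

definition trivial_basic_set :: "'a topology \<Rightarrow> ('a \<Rightarrow> 'a) \<Rightarrow> 'a set \<Rightarrow> bool" where
  "trivial_basic_set X f \<Lambda> \<longleftrightarrow>
     (\<exists>p\<in>topspace X. periodic_point f p \<and> \<Lambda> = orbit_of X f p) \<and>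
     (\<exists>U. openin X U \<and> U \<inter> nonwandering X f = \<Lambda>)"

definition stable_set ::
    "'a topology \<Rightarrow> ('a \<Rightarrow> 'a \<Rightarrow> real) \<Rightarrow> ('a \<Rightarrow> 'a) \<Rightarrow> 'a set \<Rightarrow> 'a set" where
  "stable_set X d f \<Lambda> =
     (\<Union>x\<in>\<Lambda>. {y \<in> topspace X. (\<lambda>k. d ((f ^^ k) x) ((f ^^ k) y)) \<longlonglongrightarrow> 0})"

definition unstable_set ::
    "'a topology \<Rightarrow> ('a \<Rightarrow> 'a \<Rightarrow> real) \<Rightarrow> ('a \<Rightarrow> 'a) \<Rightarrow> 'a set \<Rightarrow> 'a set" where
  "unstable_set X d f \<Lambda> =
     (\<Union>x\<in>\<Lambda>. {y \<in> topspace X. (\<lambda>k. d ((inv_on X f ^^ k) x) ((inv_on X f ^^ k) y)) \<longlonglongrightarrow> 0})"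

definition sink_basic_sets ::
    "'a topology \<Rightarrow> ('a \<Rightarrow> 'a \<Rightarrow> real) \<Rightarrow> ('a \<Rightarrow> 'a) \<Rightarrow> 'a set set" where
  "sink_basic_sets X d f = {\<Lambda> \<in> basic_sets X f. unstable_set X d f \<Lambda> = \<Lambda>}"

definition source_basic_sets ::
    "'a topology \<Rightarrow> ('a \<Rightarrow> 'a \<Rightarrow> real) \<Rightarrow> ('a \<Rightarrow> 'a) \<Rightarrow> 'a set set" where
  "source_basic_sets X d f = {\<Lambda> \<in> basic_sets X f. stable_set X d f \<Lambda> = \<Lambda>}"

definition saddle_basic_sets ::
    "'a topology \<Rightarrow> ('a \<Rightarrow> 'a \<Rightarrow> real) \<Rightarrow> ('a \<Rightarrow> 'a) \<Rightarrow> 'a set set" where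
  "saddle_basic_sets X d f =
     basic_sets X f - (sink_basic_sets X d f \<union> source_basic_sets X d f)"

definition saddle_periodic_points ::
    "'a topology \<Rightarrow> ('a \<Rightarrow> 'a \<Rightarrow> real) \<Rightarrow> ('a \<Rightarrow> 'a) \<Rightarrow> 'a set" where
  "saddle_periodic_points X d f = {p \<in> \<Union>(saddle_basic_sets X d f). periodic_point f p}"

definition regular :: "'a topology \<Rightarrow> ('a \<Rightarrow> 'a \<Rightarrow> real) \<Rightarrow> ('a \<Rightarrow> 'a) \<Rightarrow> bool" where
  "regular X d f \<longleftrightarrow>
     (\<forall>\<Lambda> \<in> sink_basic_sets X d f \<union> saddle_basic_sets X d f \<union> source_basic_sets X d f.
        trivial_basic_set X f \<Lambda>)"

definition SRH ::
    "'n::finite itself \<Rightarrow> 'a topology \<Rightarrow> ('a \<Rightarrow> 'a \<Rightarrow> real) \<Rightarrow> ('a \<Rightarrow> 'a) set" where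
  "SRH n X d = {f. Smale_A_homeomorphism n X f \<and> regular X d f}"

definition A_set :: "'a topology \<Rightarrow> ('a \<Rightarrow> 'a \<Rightarrow> real) \<Rightarrow> ('a \<Rightarrow> 'a) \<Rightarrow> 'a set" where
  "A_set X d f =
     \<Union>(sink_basic_sets X d f) \<union> (\<Union>\<nu>\<in>saddle_basic_sets X d f. unstable_set X d f \<nu>)"

definition R_set :: "'a topology \<Rightarrow> ('a \<Rightarrow> 'a \<Rightarrow> real) \<Rightarrow> ('a \<Rightarrow> 'a) \<Rightarrow> 'a set" where
  "R_set X d f =
     \<Union>(source_basic_sets X d f) \<union> (\<Union>\<nu>\<in>saddle_basic_sets X d f. stable_set X d f \<nu>)"

end

theory Submission
  imports Defs
begin

text \<open>For a regular \<open>f\<close> the non-wandering set is finite, so every point is asymptotic, both in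
  the future and in the past, to a non-wandering point. A set \<open>S\<close> of non-wandering points
  with \<open>W\<^sup>s(S) = S\<close> is then a topological repeller, without any appeal to
  hyperbolicity; applied to the union of the source orbits this shows that \<open>A(f)\<close> is the
  complement of \<open>W\<^sup>u(S)\<close> and hence an attractor whose basin is everything but the finitely
  many sources. A conjugacy given near \<open>A(f\<^sub>1)\<close> therefore extends along orbits to the
  complement of the sources, and from there to the whole manifold, because in dimension at least
  two a closed manifold is the end compactification of the complement of a finite set.
  The statement for \<open>R(f)\<close> is the one for \<open>A(f\<^sup>-\<^sup>1)\<close>.\<close>

section \<open>Extending homeomorphisms over finite sets\<close>

text \<open>Finiteness of the non-wandering set makes orbits rigid in the limit: an orbit visits a
  compact set of wandering points only finitely often, and an orbit that stays close to finitely
  many points is forced by continuity to follow one orbit among them. Hence the stable sets of the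
  basic sets partition the manifold, and so do the unstable sets. The obstacle in extending a local
  conjugacy is that the notion of embedding says nothing about the points removed from the basin.
  The image of a trapping region of \<open>f1\<close> could a priori contain sources of
  \<open>f2\<close>, and then the extension would not land in the complement of the sources.
  Periodicity excludes this: such a source would be pulled back to a periodic point of
  \<open>f1\<close> in the trapping region, which can only lie in \<open>A(f1)\<close>. This is why
  \<open>attractor_dual_to\<close> records that the points of the dual repeller are periodic and
  that all periodic points lie in one of the two sets.\<close>

definition connected_punctured_nbhds :: "'a topology \<Rightarrow> bool" where
  "connected_punctured_nbhds X \<longleftrightarrow>
     (\<forall>p G. openin X G \<and> p \<in> G \<longrightarrow>
        (\<exists>V. openin X V \<and> p \<in> V \<and> V \<subseteq> G \<and> V - {p} \<noteq> {} \<and> connectedin X (V - {p})))"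

text \<open>A punctured ball in dimension at least two is connected, and a chart carries it to the
  manifold. The later arguments use the dimension only through this property.\<close>

lemma manifold_connected_punctured_nbhds:
  assumes "topological_manifold TYPE('n::finite) X" and "CARD('n) \<ge> 2"
  shows "connected_punctured_nbhds X"
  unfolding connected_punctured_nbhds_def
proof (intro allI impI, elim conjE)
  fix p G assume G: "openin X G" "p \<in> G"
  then have "p \<in> topspace X" using openin_subset by blast
  then obtain c :: "('a, 'n) chart" where c: "is_chart X c" "p \<in> fst c"
    using assms(1) unfolding topological_manifold_def by blast
  define D \<phi> E where "D = fst c" and "\<phi> = snd c" and "E = \<phi> ` D"
  have D: "openin X D" "p \<in> D" and E: "open E"
    and hom: "homeomorphic_map (subtopology X D) (top_of_set E) \<phi>"
    using c by (auto simp: is_chart_def D_def \<phi>_def E_def)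
  obtain \<psi> where \<psi>: "homeomorphic_maps (subtopology X D) (top_of_set E) \<phi> \<psi>"
    using hom homeomorphic_map_maps by blast
  have DX: "D \<subseteq> topspace X" using D(1) openin_subset by blast
  have inv: "\<And>x. x \<in> D \<Longrightarrow> \<psi> (\<phi> x) = x" "\<And>y. y \<in> E \<Longrightarrow> \<phi> (\<psi> y) = y"
    and contphi: "continuous_map (subtopology X D) (top_of_set E) \<phi>"
    and contpsi: "continuous_map (top_of_set E) (subtopology X D) \<psi>"
    using \<psi> DX unfolding homeomorphic_maps_def by auto
  have \<psi>D: "\<psi> y \<in> D" if "y \<in> E" for y using that inv(1) E_def by auto
  have "openin (subtopology X D) (D \<inter> G)"
    using G(1) openin_subtopology_Int2 by blast
  then have "openin (top_of_set E) (\<phi> ` (D \<inter> G))"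
    using hom homeomorphic_map_openness_eq by blast
  then have "open (\<phi> ` (D \<inter> G))"
    using E openin_open_trans by blast
  then obtain r where r: "r > 0" "ball (\<phi> p) r \<subseteq> \<phi> ` (D \<inter> G)"
    using D(2) G(2) open_contains_ball by (metis IntI imageI)
  define B where "B = ball (\<phi> p) r"
  have BE: "B \<subseteq> E" using r by (auto simp: B_def E_def)
  have phip: "\<phi> p \<in> B" using r by (simp add: B_def)
  define V where "V = {x \<in> D. \<phi> x \<in> B}"
  have "openin (subtopology X D) {x \<in> topspace (subtopology X D). \<phi> x \<in> B}"
    using contphi BE by (intro openin_continuous_map_preimage[of _ "top_of_set E"])
      (auto simp: B_def openin_open_eq[OF E])
  then have "openin (subtopology X D) V" using DX by (simp add: V_def Int_absorb1)
  then have 1: "openin X V" using D(1) openin_trans_full by blast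
  have 2: "p \<in> V" using D phip by (simp add: V_def)
  have 3: "V \<subseteq> G"
  proof
    fix x assume x: "x \<in> V"
    then obtain y where "y \<in> D \<inter> G" "\<phi> x = \<phi> y" using r(2) unfolding V_def B_def by blast
    then show "x \<in> G" using inv(1)[of x] inv(1)[of y] x by (auto simp: V_def)
  qed
  have eq: "V - {p} = \<psi> ` (B - {\<phi> p})"
  proof
    show "V - {p} \<subseteq> \<psi> ` (B - {\<phi> p})"
    proof
      fix x assume x: "x \<in> V - {p}"
      then have "x \<in> D" "\<phi> x \<in> B" "x \<noteq> p" by (auto simp: V_def)
      then have "\<psi> (\<phi> x) = x" "\<phi> x \<noteq> \<phi> p" using inv(1)[of x] inv(1)[OF D(2)] by auto
      with \<open>\<phi> x \<in> B\<close> show "x \<in> \<psi> ` (B - {\<phi> p})" by (metis DiffI image_eqI singletonD)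
    qed
    show "\<psi> ` (B - {\<phi> p}) \<subseteq> V - {p}" using BE \<psi>D inv(2) by (auto simp: V_def)
  qed
  have dim: "2 \<le> DIM(real^'n)" using assms(2) by simp
  have "connectedin (top_of_set E) (B - {\<phi> p})"
    using connected_punctured_ball[OF dim, of "\<phi> p" r] BE
    by (auto simp: connectedin_subtopology B_def connectedin_iff_connected)
  then have "connectedin (subtopology X D) (\<psi> ` (B - {\<phi> p}))"
    using contpsi connectedin_continuous_map_image by blast
  then have 4: "connectedin X (V - {p})" using eq by (simp add: connectedin_subtopology)
  have "infinite B" unfolding B_def
    using r(1) uncountable_ball by (metis countable_finite)
  then have "B - {\<phi> p} \<noteq> {}" by (metis finite.emptyI finite_insert finite_subset insert_Diff phip)
  then have "V - {p} \<noteq> {}" using eq by simp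
  with 1 2 3 4 show "\<exists>V. openin X V \<and> p \<in> V \<and> V \<subseteq> G \<and> V - {p} \<noteq> {} \<and> connectedin X (V - {p})"
    by blast
qed

text \<open>In a Hausdorff space a finite open set would consist of isolated points, and these have
  no non-empty punctured neighbourhoods inside themselves.\<close>

lemma connected_punctured_nbhds_infinite:
  assumes "connected_punctured_nbhds X" "Hausdorff_space X" "openin X U" "U \<noteq> {}"
  shows "infinite U"
proof
  assume fin: "finite U"
  obtain p where p: "p \<in> U" using assms(4) by blast
  have UX: "U \<subseteq> topspace X" using assms(3) openin_subset by blast
  have "closedin X (U - {p})"
    using fin UX assms(2) by (intro closedin_Hausdorff_finite) auto
  then have "openin X (U - (U - {p}))" using assms(3) openin_diff by blast
  moreover have "U - (U - {p}) = {p}" using p by blast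
  ultimately have "openin X {p}" by simp
  then show False using assms(1) unfolding connected_punctured_nbhds_def by blast
qed

text \<open>This density lets identities between continuous maps pass from the complement of a
  finite set to the whole space.\<close>

lemma closure_of_Diff_finite:
  assumes "connected_punctured_nbhds X" "Hausdorff_space X" "finite S"
  shows "X closure_of (topspace X - S) = topspace X"
proof
  show "X closure_of (topspace X - S) \<subseteq> topspace X" by (rule closure_of_subset_topspace)
  show "topspace X \<subseteq> X closure_of (topspace X - S)"
  proof
    fix x assume x: "x \<in> topspace X"
    have "\<exists>y. y \<in> topspace X - S \<and> y \<in> T" if T: "x \<in> T" "openin X T" for T
    proof -
      have "infinite T" using connected_punctured_nbhds_infinite[OF assms(1,2) T(2)] T(1) by blast
      then have "\<not> T \<subseteq> S" using assms(3) finite_subset by blast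
      then show ?thesis using T openin_subset by blast
    qed
    then show "x \<in> X closure_of (topspace X - S)" using x by (auto simp: in_closure_of)
  qed
qed

section \<open>Filling in finitely many missing points\<close>

lemma Hausdorff_disjoint_nbhds_finite:
  assumes "Hausdorff_space X" "finite S" "S \<subseteq> topspace X"
  obtains V where "\<And>q. q \<in> S \<Longrightarrow> openin X (V q) \<and> q \<in> V q"
    and "\<And>q r. q \<in> S \<Longrightarrow> r \<in> S \<Longrightarrow> q \<noteq> r \<Longrightarrow> V q \<inter> V r = {}"
proof -
  have "\<exists>A. (openin X (fst A) \<and> openin X (snd A) \<and> q \<in> fst A \<and> r \<in> snd A \<and> fst A \<inter> snd A = {})"
    if "q \<in> S" "r \<in> S" "q \<noteq> r" for q r
  proof -
    from that have "q \<in> topspace X" "r \<in> topspace X" using assms(3) by auto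
    then obtain U W where "openin X U \<and> openin X W \<and> q \<in> U \<and> r \<in> W \<and> disjnt U W"
      using assms(1) \<open>q \<noteq> r\<close> unfolding Hausdorff_space_def by blast
    then show ?thesis by (intro exI[of _ "(U, W)"]) (auto simp: disjnt_def)
  qed
  then obtain A where A: "\<And>q r. q \<in> S \<Longrightarrow> r \<in> S \<Longrightarrow> q \<noteq> r \<Longrightarrow> 
     openin X (fst (A q r)) \<and> openin X (snd (A q r)) \<and> q \<in> fst (A q r) \<and> r \<in> snd (A q r) \<and>
     fst (A q r) \<inter> snd (A q r) = {}" by metis
  \<comment> \<open>The pairs \<open>A q r\<close> and \<open>A r q\<close> are chosen
    independently, so \<open>V q\<close> must respect both. The factor \<open>topspace X\<close>
    covers \<open>S = {q}\<close>, where the intersection over the empty family is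
    \<open>UNIV\<close>.\<close>
  define V where "V q = topspace X \<inter> \<Inter>((\<lambda>r. fst (A q r) \<inter> snd (A r q)) ` (S - {q}))" for q
  have "openin X (V q)" if "q \<in> S" for q
  proof (cases "S - {q} = {}")
    case False
    have "openin X (\<Inter>((\<lambda>r. fst (A q r) \<inter> snd (A r q)) ` (S - {q})))"
      using A that assms(2) False by (intro openin_Inter) (auto intro!: openin_Int)
    then show ?thesis unfolding V_def by (intro openin_Int openin_topspace)
  next
    case True
    then show ?thesis by (simp only: V_def image_empty Inter_empty Int_UNIV_right openin_topspace)
  qed
  moreover have "q \<in> V q" if "q \<in> S" for q using A that assms(3) unfolding V_def by auto
  moreover have "V q \<inter> V r = {}" if "q \<in> S" "r \<in> S" "q \<noteq> r" for q r
  proof -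
    have "V q \<subseteq> fst (A q r)" "V r \<subseteq> snd (A q r)" using that unfolding V_def by auto
    then show ?thesis using A[OF that] by blast
  qed
  ultimately show ?thesis using that[of V] by blast
qed

lemma connectedin_subset_disjoint_Union:
  assumes "connectedin X C" "C \<noteq> {}" "C \<subseteq> (\<Union>q\<in>S. V q)"
    and "\<And>q. q \<in> S \<Longrightarrow> openin X (V q)"
    and "\<And>q r. q \<in> S \<Longrightarrow> r \<in> S \<Longrightarrow> q \<noteq> r \<Longrightarrow> V q \<inter> V r = {}"
  obtains q where "q \<in> S" "C \<subseteq> V q"
proof -
  obtain q where q: "q \<in> S" "C \<inter> V q \<noteq> {}" using assms(2,3) by blast
  define W where "W = (\<Union>r\<in>S - {q}. V r)"
  have "openin X W" unfolding W_def using assms(4) by blast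
  moreover have "C \<subseteq> V q \<union> W" using assms(3) unfolding W_def by blast
  moreover have "V q \<inter> W = {}" using assms(5) q unfolding W_def by blast
  moreover have "openin X (V q)" using assms(4) q(1) .
  moreover have "V q \<inter> C \<noteq> {}" using q(2) by (simp add: Int_commute)
  ultimately have "W \<inter> C = {}"
    using connectedinD[OF assms(1), of "V q" W] by (metis inf_bot_left)
  then have "C \<subseteq> V q" using \<open>C \<subseteq> V q \<union> W\<close> by blast
  with q that show ?thesis by blast
qed

text \<open>Since punctured neighbourhoods are connected, \<open>X\<close> is the end compactification of
  the complement of every finite set; a homeomorphism between two such complements therefore
  induces a bijection between the removed points.\<close>

lemma homeomorphism_off_finite_limit:
  assumes X: "compact_space X" "Hausdorff_space X" "connected_punctured_nbhds X"
    and S: "finite S" "finite S'" "S' \<subseteq> topspace X"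
    and k: "homeomorphic_maps (subtopology X (topspace X - S)) (subtopology X (topspace X - S')) k k'"
    and p: "p \<in> S" "p \<in> topspace X"
  shows "\<exists>q\<in>topspace X. \<forall>W. openin X W \<and> q \<in> W \<longrightarrow>
           (\<exists>G. openin X G \<and> p \<in> G \<and> (\<forall>x\<in>G - {p}. x \<notin> S \<and> k x \<in> W))"
proof -
  let ?Y = "topspace X - S" and ?Y' = "topspace X - S'"
  have kk: "continuous_map (subtopology X ?Y) (subtopology X ?Y') k"
      "continuous_map (subtopology X ?Y') (subtopology X ?Y) k'"
      "\<And>x. x \<in> ?Y \<Longrightarrow> k' (k x) = x" "\<And>x. x \<in> ?Y \<Longrightarrow> k x \<in> ?Y'"
    using k unfolding homeomorphic_maps_def continuous_map_def by auto
  obtain V where V: "\<And>q. q \<in> S' \<Longrightarrow> openin X (V q) \<and> q \<in> V q"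
    and disj: "\<And>q r. q \<in> S' \<Longrightarrow> r \<in> S' \<Longrightarrow> q \<noteq> r \<Longrightarrow> V q \<inter> V r = {}"
    using Hausdorff_disjoint_nbhds_finite[OF X(2) S(2,3)] by metis
  \<comment> \<open>Properness of \<open>k\<close>: outside a neighbourhood of \<open>S'\<close> the
    space is compact, so \<open>k'\<close> carries that part to a compact set missing
    \<open>p\<close>. Points close enough to \<open>p\<close> are therefore sent close to
    \<open>S'\<close>.\<close>
  have near: "\<exists>G. openin X G \<and> p \<in> G \<and> (\<forall>x\<in>G - {p}. x \<notin> S \<and> k x \<in> (\<Union>q\<in>S'. W q))"
    if W: "\<And>q. q \<in> S' \<Longrightarrow> openin X (W q) \<and> q \<in> W q" for W
  proof -
    define K where "K = topspace X - (\<Union>q\<in>S'. W q)"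
    have "openin X (\<Union>q\<in>S'. W q)" using W by blast
    then have "closedin X K" unfolding K_def by blast
    then have "compactin X K" using X(1) closedin_compact_space by blast
    moreover have KY: "K \<subseteq> ?Y'" using W unfolding K_def by blast
    ultimately have "compactin (subtopology X ?Y') K" by (simp add: compactin_subtopology)
    then have "compactin (subtopology X ?Y) (k' ` K)" using kk(2) image_compactin by blast
    then have c: "compactin X (k' ` K)" "k' ` K \<subseteq> ?Y" by (auto simp: compactin_subtopology)
    then have cl: "closedin X (k' ` K)" using X(2) compactin_imp_closedin by blast
    have cS: "closedin X (topspace X \<inter> (S - {p}))"
      using S(1) X(2) by (intro closedin_Hausdorff_finite) auto
    define G where "G = topspace X - (k' ` K \<union> (topspace X \<inter> (S - {p})))"
    have "openin X G" unfolding G_def using cl cS by blast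
    moreover have "p \<in> G" using p c(2) unfolding G_def by blast
    moreover have "x \<notin> S \<and> k x \<in> (\<Union>q\<in>S'. W q)" if x: "x \<in> G - {p}" for x
    proof -
      have xY: "x \<in> ?Y" and nK: "x \<notin> k' ` K" using x unfolding G_def by auto
      have "k x \<notin> K" using nK kk(3)[OF xY] by (metis imageI)
      then show ?thesis using kk(4)[OF xY] xY unfolding K_def by blast
    qed
    ultimately show ?thesis by blast
  qed
  obtain G where G: "openin X G" "p \<in> G" "\<And>x. x \<in> G - {p} \<Longrightarrow> x \<notin> S \<and> k x \<in> (\<Union>q\<in>S'. V q)"
    using near[of V, OF V] by auto
  \<comment> \<open>The image of a connected punctured neighbourhood cannot be spread over several
    of the disjoint sets \<open>V q\<close>; this singles out the limit point.\<close>
  obtain G0 where G0: "openin X G0" "p \<in> G0" "G0 \<subseteq> G" "G0 - {p} \<noteq> {}" "connectedin X (G0 - {p})"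
    using X(3)[unfolded connected_punctured_nbhds_def, rule_format, of G p] G(1,2) by auto
  have G0Y: "G0 - {p} \<subseteq> ?Y" using openin_subset[OF G0(1)] G0(3) G(3) by auto
  then have "connectedin (subtopology X ?Y) (G0 - {p})" using G0(5) by (simp add: connectedin_subtopology)
  then have "connectedin (subtopology X ?Y') (k ` (G0 - {p}))"
    using kk(1) connectedin_continuous_map_image by blast
  then have con: "connectedin X (k ` (G0 - {p}))" by (simp add: connectedin_subtopology)
  obtain q where q: "q \<in> S'" "k ` (G0 - {p}) \<subseteq> V q"
  proof (rule connectedin_subset_disjoint_Union[OF con])
    show "k ` (G0 - {p}) \<noteq> {}" using G0(4) by blast
    show "k ` (G0 - {p}) \<subseteq> (\<Union>q\<in>S'. V q)"
    proof (rule image_subsetI)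
      fix x assume "x \<in> G0 - {p}"
      then show "k x \<in> (\<Union>q\<in>S'. V q)" using G(3)[of x] G0(3) by auto
    qed
  qed (use V disj in auto)
  show ?thesis
  proof (intro bexI[of _ q] allI impI, elim conjE)
    fix W assume W: "openin X W" "q \<in> W"
    \<comment> \<open>Only the neighbourhood of \<open>q\<close> is shrunk: on \<open>G0\<close> the
      values already lie in \<open>V q\<close>, so the other members of the family cannot contain
      them.\<close>
    define V' where "V' = V(q := V q \<inter> W)"
    have "openin X (V' r) \<and> r \<in> V' r" if "r \<in> S'" for r
      using V[OF that] W by (auto simp: V'_def)
    then obtain G1 where G1: "openin X G1" "p \<in> G1"
        "\<And>x. x \<in> G1 - {p} \<Longrightarrow> x \<notin> S \<and> k x \<in> (\<Union>r\<in>S'. V' r)"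
      using near[of V'] by auto
    have "k x \<in> W" if x: "x \<in> G1 \<inter> G0 - {p}" for x
    proof -
      obtain r where r: "r \<in> S'" "k x \<in> V' r" using G1(3)[of x] x by blast
      have kq: "k x \<in> V q" using q(2) x by blast
      show ?thesis
      proof (cases "r = q")
        case False
        then have "k x \<in> V r" using r by (simp add: V'_def)
        then show ?thesis using disj[OF q(1) r(1)] False kq by blast
      qed (use r in \<open>simp add: V'_def\<close>)
    qed
    then show "\<exists>G. openin X G \<and> p \<in> G \<and> (\<forall>x\<in>G - {p}. x \<notin> S \<and> k x \<in> W)"
      using G1 G0(1,2) by (intro exI[of _ "G1 \<inter> G0"]) auto
  qed (use q S(3) in blast)
qed

lemma continuous_extension_off_finite:
  assumes X: "compact_space X" "Hausdorff_space X" "connected_punctured_nbhds X"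
    and S: "finite S" "S \<subseteq> topspace X" "finite S'" "S' \<subseteq> topspace X"
    and k: "homeomorphic_maps (subtopology X (topspace X - S)) (subtopology X (topspace X - S')) k k'"
  obtains h where "continuous_map X X h" "\<And>x. x \<in> topspace X - S \<Longrightarrow> h x = k x"
proof -
  let ?Y = "topspace X - S"
  have "\<forall>p\<in>S. \<exists>q\<in>topspace X. \<forall>W. openin X W \<and> q \<in> W \<longrightarrow>
           (\<exists>G. openin X G \<and> p \<in> G \<and> (\<forall>x\<in>G - {p}. x \<notin> S \<and> k x \<in> W))"
    using homeomorphism_off_finite_limit[OF X S(1,3,4) k] S(2) by blast
  then obtain q where q: "\<And>p. p \<in> S \<Longrightarrow> q p \<in> topspace X"
      "\<And>p W. p \<in> S \<Longrightarrow> openin X W \<Longrightarrow> q p \<in> W \<Longrightarrow>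
           (\<exists>G. openin X G \<and> p \<in> G \<and> (\<forall>x\<in>G - {p}. x \<notin> S \<and> k x \<in> W))"
    by metis
  define h where "h x = (if x \<in> S then q x else k x)" for x
  have kc: "continuous_map (subtopology X ?Y) X k"
    using k continuous_map_in_subtopology unfolding homeomorphic_maps_def by blast
  have kX: "k x \<in> topspace X" if "x \<in> ?Y" for x
    using kc that unfolding continuous_map_def by auto
  have oY: "openin X ?Y" using S(1,2) X(2) closedin_Hausdorff_finite by blast
  have "continuous_map X X h"
  proof -
    have "\<exists>U. openin X U \<and> x \<in> U \<and> (\<forall>y\<in>U. h y \<in> W)"
      if x: "x \<in> topspace X" and W: "openin X W" "h x \<in> W" for x W
    proof (cases "x \<in> S")
      case True
      then obtain G where "openin X G" "x \<in> G" "\<forall>y\<in>G - {x}. y \<notin> S \<and> k y \<in> W"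
        using q(2)[OF True W(1)] W(2) by (auto simp: h_def)
      then show ?thesis using W(2) by (intro exI[of _ G]) (auto simp: h_def)
    next
      case False
      have "openin (subtopology X ?Y) {y \<in> topspace (subtopology X ?Y). k y \<in> W}"
        using kc W(1) openin_continuous_map_preimage by blast
      then have "openin X {y \<in> topspace (subtopology X ?Y). k y \<in> W}"
        using oY openin_trans_full by blast
      then show ?thesis using False x W(2)
        by (intro exI[of _ "{y \<in> topspace (subtopology X ?Y). k y \<in> W}"]) (auto simp: h_def)
    qed
    moreover have "h x \<in> topspace X" if "x \<in> topspace X" for x
      using that q(1) kX by (simp add: h_def)
    ultimately show ?thesis
      by (simp add: continuous_map_eq_topcontinuous_at topcontinuous_at_def)
  qed
  then show ?thesis using that[of h] by (simp add: h_def)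
qed

text \<open>Both \<open>k\<close> and \<open>k'\<close> extend continuously, and the two
  compositions are the identity on dense sets, hence everywhere. In this way no bijection between
  \<open>S\<close> and \<open>S'\<close> has to be constructed.\<close>

lemma homeomorphism_extension_off_finite:
  assumes X: "compact_space X" "Hausdorff_space X" "connected_punctured_nbhds X"
    and S: "finite S" "S \<subseteq> topspace X" "finite S'" "S' \<subseteq> topspace X"
    and k: "homeomorphic_maps (subtopology X (topspace X - S)) (subtopology X (topspace X - S')) k k'"
  obtains h where "homeomorphic_map X X h" "\<And>x. x \<in> topspace X - S \<Longrightarrow> h x = k x"
proof -
  let ?Y = "topspace X - S" and ?Y' = "topspace X - S'"
  obtain h where h: "continuous_map X X h" "\<And>x. x \<in> ?Y \<Longrightarrow> h x = k x"
    using continuous_extension_off_finite[OF assms] by metis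
  obtain h' where h': "continuous_map X X h'" "\<And>x. x \<in> ?Y' \<Longrightarrow> h' x = k' x"
    using continuous_extension_off_finite[OF X S(3,4,1,2)] k homeomorphic_maps_sym by metis
  have kk: "\<And>x. x \<in> ?Y \<Longrightarrow> k x \<in> ?Y' \<and> k' (k x) = x" "\<And>x. x \<in> ?Y' \<Longrightarrow> k' x \<in> ?Y \<and> k (k' x) = x"
    using k unfolding homeomorphic_maps_def continuous_map_def by auto
  have "h' (h x) = x" if "x \<in> topspace X" for x
  proof -
    have "(h' \<circ> h) x = id x"
    proof (rule forall_in_closure_of_eq[where f = "h' \<circ> h" and g = id and x = x and X = X and Y = X and S = ?Y])
      show "x \<in> X closure_of ?Y" using that closure_of_Diff_finite[OF X(3,2) S(1)] by simp
      show "continuous_map X X (h' \<circ> h)" using h h' continuous_map_compose by blast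
    qed (use X h h' kk in auto)
    then show ?thesis by simp
  qed
  moreover have "h (h' x) = x" if "x \<in> topspace X" for x
  proof -
    have "(h \<circ> h') x = id x"
    proof (rule forall_in_closure_of_eq[where f = "h \<circ> h'" and g = id and x = x and X = X and Y = X and S = ?Y'])
      show "x \<in> X closure_of ?Y'" using that closure_of_Diff_finite[OF X(3,2) S(3)] by simp
      show "continuous_map X X (h \<circ> h')" using h h' continuous_map_compose by blast
    qed (use X h h' kk in auto)
    then show ?thesis by simp
  qed
  ultimately have "homeomorphic_maps X X h h'" using h h' by (simp add: homeomorphic_maps_def)
  then have "homeomorphic_map X X h" by (rule homeomorphic_maps_imp_map)
  then show ?thesis using h(2) that by blast
qed

section \<open>Attractors and extension of conjugacies\<close>

lemma homeomorphic_mapsD: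
  assumes "homeomorphic_maps X Y f g"
  shows "continuous_map X Y f" "continuous_map Y X g"
    "x \<in> topspace X \<Longrightarrow> f x \<in> topspace Y" "y \<in> topspace Y \<Longrightarrow> g y \<in> topspace X"
    "x \<in> topspace X \<Longrightarrow> g (f x) = x" "y \<in> topspace Y \<Longrightarrow> f (g y) = y"
  using assms by (auto simp: homeomorphic_maps_def continuous_map_def)

lemma homeomorphic_maps_funpow:
  assumes "homeomorphic_maps X X f g"
  shows "homeomorphic_maps X X (f ^^ k) (g ^^ k)"
proof (induction k)
  case 0
  show ?case by (simp add: homeomorphic_maps_def)
next
  case (Suc k)
  have "homeomorphic_maps X X (f \<circ> f ^^ k) (g ^^ k \<circ> g)"
    using Suc assms homeomorphic_maps_compose by blast
  then show ?case by (simp only: funpow_Suc_right[of k g] funpow.simps(2)[of k f])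
qed

lemma homeomorphic_maps_inv_on:
  assumes "homeomorphic_map X X f"
  shows "homeomorphic_maps X X f (inv_on X f)"
proof -
  obtain g where g: "homeomorphic_maps X X f g" using assms homeomorphic_map_maps by blast
  have inj: "inj_on f (topspace X)" using assms by (simp add: homeomorphic_eq_everything_map)
  have "g x = inv_on X f x" if "x \<in> topspace X" for x
    using homeomorphic_mapsD(4,6)[OF g that] inv_into_f_f[OF inj, of "g x"] by (simp add: inv_on_def)
  then show ?thesis using homeomorphic_maps_eq[OF g] by metis
qed

lemma funpow_in: "(\<And>x. x \<in> S \<Longrightarrow> f x \<in> S) \<Longrightarrow> x \<in> S \<Longrightarrow> (f ^^ k) x \<in> S"
  by (induction k) auto

lemma homeomorphic_maps_invariant_swap:
  assumes "homeomorphic_maps X X f g" "S \<subseteq> topspace X" "f ` S = S"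
  shows "g ` S = S"
proof -
  have "g ` f ` S = S" using homeomorphic_mapsD(5)[OF assms(1)] assms(2) by (force simp: image_image)
  then show ?thesis using assms(3) by simp
qed

text \<open>\<open>S\<close> is the dual repeller of the attractor \<open>A\<close>.\<close>

definition attractor_dual_to :: "'a topology \<Rightarrow> ('a \<Rightarrow> 'a) \<Rightarrow> 'a set \<Rightarrow> 'a set \<Rightarrow> bool" where
  "attractor_dual_to X f A S \<longleftrightarrow>
     closedin X A \<and> f ` A = A \<and> finite S \<and> S \<subseteq> topspace X \<and> f ` S = S \<and> A \<inter> S = {} \<and>
     (\<forall>x\<in>S. periodic_point f x) \<and> (\<forall>x\<in>topspace X. periodic_point f x \<longrightarrow> x \<in> A \<union> S) \<and>
     (\<forall>G. openin X G \<and> A \<subseteq> G \<longrightarrow>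
        (\<exists>U. openin X U \<and> A \<subseteq> U \<and> U \<subseteq> G \<and> U \<inter> S = {} \<and> f ` U \<subseteq> U)) \<and>
     (\<forall>G x. openin X G \<and> A \<subseteq> G \<and> x \<in> topspace X - S \<longrightarrow> (\<exists>k. (f ^^ k) x \<in> G))"

section \<open>Propagating a local conjugacy along orbits\<close>

lemma conjugacy_iterate:
  assumes "f1 ` U \<subseteq> U" "\<And>x. x \<in> U \<Longrightarrow> h (f1 x) = f2 (h x)" "x \<in> U"
  shows "h ((f1 ^^ k) x) = (f2 ^^ k) (h x)"
proof (induction k)
  case (Suc k)
  have "(f1 ^^ k) x \<in> U" using assms(1,3) by (intro funpow_in) auto
  then show ?case using assms(2) Suc by simp
qed simp

text \<open>Every entry time \<open>k\<close> into \<open>U\<close> gives the same value, because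
  \<open>h\<close> intertwines the maps on the forward invariant set \<open>U\<close>. Since
  \<open>U\<close> is open, an entry time of \<open>x\<close> also serves all nearby points, so
  \<open>H\<close> is locally a composition of continuous maps.\<close>

lemma glue_conjugacy:
  assumes f1: "homeomorphic_maps X X f1 g1" and f2: "homeomorphic_maps X X f2 g2"
    and U: "openin X U" "f1 ` U \<subseteq> U" and h: "continuous_map (subtopology X U) X h"
    and eq: "\<And>x. x \<in> U \<Longrightarrow> h (f1 x) = f2 (h x)"
    and D: "\<And>x. x \<in> D \<Longrightarrow> \<exists>k. (f1 ^^ k) x \<in> U" "D \<subseteq> topspace X"
  obtains H where "continuous_map (subtopology X D) X H"
    "\<And>x k. x \<in> D \<Longrightarrow> (f1 ^^ k) x \<in> U \<Longrightarrow> H x = (g2 ^^ k) (h ((f1 ^^ k) x))"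
proof -
  define H where "H x = (let k = (LEAST k. (f1 ^^ k) x \<in> U) in (g2 ^^ k) (h ((f1 ^^ k) x)))" for x
  have hX: "h x \<in> topspace X" if "x \<in> U" for x
    using h that openin_subset[OF U(1)] by (auto simp: continuous_map_def)
  have val: "H x = (g2 ^^ k) (h ((f1 ^^ k) x))" if k: "(f1 ^^ k) x \<in> U" for x k
  proof -
    define m where "m = (LEAST k. (f1 ^^ k) x \<in> U)"
    have m: "(f1 ^^ m) x \<in> U" "m \<le> k" using k by (auto simp: m_def intro: LeastI Least_le)
    then obtain j where j: "k = m + j" using le_Suc_ex by blast
    have "h ((f1 ^^ k) x) = h ((f1 ^^ j) ((f1 ^^ m) x))" by (simp add: j funpow_add add.commute[of m])
    also have "\<dots> = (f2 ^^ j) (h ((f1 ^^ m) x))" using U(2) eq m(1) by (rule conjugacy_iterate)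
    finally have "(g2 ^^ k) (h ((f1 ^^ k) x)) = (g2 ^^ m) ((g2 ^^ j) ((f2 ^^ j) (h ((f1 ^^ m) x))))"
      by (simp add: j funpow_add)
    also have "\<dots> = (g2 ^^ m) (h ((f1 ^^ m) x))"
      using homeomorphic_mapsD(5)[OF homeomorphic_maps_funpow[OF f2] hX[OF m(1)]] by simp
    finally show ?thesis by (simp only: H_def m_def Let_def)
  qed
  have "continuous_map (subtopology X D) X H"
  proof -
    have "\<exists>T. openin (subtopology X D) T \<and> x \<in> T \<and> (\<forall>y\<in>T. H y \<in> W)"
      if x: "x \<in> D" and W: "openin X W" "H x \<in> W" for x W
    proof -
      obtain k where k: "(f1 ^^ k) x \<in> U" using D(1) x by blast
      have "continuous_map X X (g2 ^^ k)"
        using homeomorphic_mapsD(2)[OF homeomorphic_maps_funpow[OF f2]] .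
      then have c: "continuous_map (subtopology X U) X (\<lambda>y. (g2 ^^ k) (h y))"
        using continuous_map_compose[OF h] by (simp add: comp_def)
      define V where "V = {y \<in> topspace (subtopology X U). (g2 ^^ k) (h y) \<in> W}"
      have "openin (subtopology X U) V"
        unfolding V_def using c W(1) by (rule openin_continuous_map_preimage)
      then have V: "openin X V" using U(1) openin_trans_full by blast
      have "continuous_map X X (f1 ^^ k)"
        using homeomorphic_mapsD(1)[OF homeomorphic_maps_funpow[OF f1]] .
      then have "openin X {y \<in> topspace X. (f1 ^^ k) y \<in> V}"
        using V openin_continuous_map_preimage by blast
      then have "openin (subtopology X D) (D \<inter> {y \<in> topspace X. (f1 ^^ k) y \<in> V})"
        by (rule openin_subtopology_Int2)
      moreover have "x \<in> D \<inter> {y \<in> topspace X. (f1 ^^ k) y \<in> V}"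
        using x k W(2) val[OF k] D(2) openin_subset[OF U(1)] by (auto simp: V_def)
      moreover have "H y \<in> W" if "y \<in> D \<inter> {y \<in> topspace X. (f1 ^^ k) y \<in> V}" for y
        using that val[of k y] by (auto simp: V_def)
      ultimately show ?thesis by blast
    qed
    moreover have "H x \<in> topspace X" if x: "x \<in> D" for x
    proof -
      obtain k where k: "(f1 ^^ k) x \<in> U" using D(1) x by blast
      show ?thesis unfolding val[OF k]
        using homeomorphic_mapsD(4)[OF homeomorphic_maps_funpow[OF f2] hX[OF k]] .
    qed
    ultimately show ?thesis
      using D(2) by (simp add: continuous_map_eq_topcontinuous_at topcontinuous_at_def Int_absorb1)
  qed
  then show ?thesis using val that by blast
qed

text \<open>The equation is required only where \<open>f1 x\<close> stays in \<open>G1\<close>, so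
  that the lemma also applies to inverse maps, for which a local conjugacy yields no more than that.
  Inside a trapping region \<open>U1\<close> the side condition holds automatically.\<close>

lemma conjugacy_from_germ:
  assumes X: "compact_space X" "Hausdorff_space X" "connected_punctured_nbhds X"
    and f1: "homeomorphic_maps X X f1 g1" and f2: "homeomorphic_maps X X f2 g2"
    and A: "attractor_dual_to X f1 A1 S1" "attractor_dual_to X f2 A2 S2"
    and G: "openin X G1" "A1 \<subseteq> G1" "openin X G2"
    and h: "homeomorphic_maps (subtopology X G1) (subtopology X G2) h h'" "h ` A1 = A2"
    and eq: "\<And>x. x \<in> G1 \<Longrightarrow> f1 x \<in> G1 \<Longrightarrow> h (f1 x) = f2 (h x)"
  obtains H where "homeomorphic_map X X H" "\<And>x. x \<in> topspace X \<Longrightarrow> H (f1 x) = f2 (H x)"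
proof -
  let ?D1 = "topspace X - S1" and ?D2 = "topspace X - S2"
  have S: "finite S1" "S1 \<subseteq> topspace X" "f1 ` S1 = S1" "finite S2" "S2 \<subseteq> topspace X"
    "f2 ` S2 = S2" "A2 \<inter> S2 = {}" "\<And>x. x \<in> S2 \<Longrightarrow> periodic_point f2 x"
    "\<And>x. x \<in> topspace X \<Longrightarrow> periodic_point f1 x \<Longrightarrow> x \<in> A1 \<union> S1"
    using A unfolding attractor_dual_to_def by auto
  obtain U1 where U1: "openin X U1" "A1 \<subseteq> U1" "U1 \<subseteq> G1" "U1 \<inter> S1 = {}" "f1 ` U1 \<subseteq> U1"
    using A(1) G(1,2) unfolding attractor_dual_to_def by metis
  have ab1: "\<exists>k. (f1 ^^ k) x \<in> U1" if "x \<in> ?D1" for x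
    using A(1) U1(1,2) that unfolding attractor_dual_to_def by metis
  have GX: "G1 \<subseteq> topspace X" "G2 \<subseteq> topspace X" using G openin_subset by auto
  have tG: "topspace (subtopology X G1) = G1" "topspace (subtopology X G2) = G2"
    using GX by auto
  note hD = homeomorphic_mapsD[OF h(1), unfolded tG]
  \<comment> \<open>Transporting the trapping region by \<open>h\<close>, instead of choosing one
    for \<open>f2\<close>, makes \<open>h\<close> and \<open>h'\<close> mutually inverse between two
    forward invariant sets.\<close>
  define U2 where "U2 = h ` U1"
  have "openin (subtopology X G1) U1"
    using U1(1,3) by (simp add: G(1) openin_open_subtopology)
  then have "openin (subtopology X G2) U2"
    using homeomorphic_map_openness_eq[OF homeomorphic_maps_imp_map[OF h(1)]] unfolding U2_def by blast
  then have U2: "openin X U2" "U2 \<subseteq> G2" using G(3) openin_open_subtopology by blast+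
  have A2U2: "A2 \<subseteq> U2" using h(2) U1(2) by (auto simp: U2_def)
  have eq1: "h (f1 x) = f2 (h x)" if "x \<in> U1" for x
    using that U1(3,5) by (intro eq) auto
  have inv1: "h' (h x) = x" if "x \<in> U1" for x using hD(5) that U1(3) by auto
  have U2f: "f2 ` U2 \<subseteq> U2"
  proof -
    have "f2 (h x) \<in> U2" if "x \<in> U1" for x
      using that U1(5) unfolding U2_def eq1[OF that, symmetric] by auto
    then show ?thesis by (auto simp: U2_def)
  qed
  have U2h: "h' y \<in> U1" "h (h' y) = y" if "y \<in> U2" for y
    using that inv1 by (auto simp: U2_def)
  have eq2: "h' (f2 y) = f1 (h' y)" if "y \<in> U2" for y
  proof -
    have "h' (f2 y) = h' (h (f1 (h' y)))" using eq1 U2h[OF that] by simp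
    also have "\<dots> = f1 (h' y)" using U2h(1)[OF that] U1(5) by (intro inv1) auto
    finally show ?thesis .
  qed
  \<comment> \<open>A point of \<open>S2\<close> in \<open>U2\<close> is periodic with its orbit in
    \<open>U2\<close>, so \<open>h'\<close> sends it to a periodic point of \<open>f1\<close> in
    \<open>U1\<close>. That point misses \<open>S1\<close>, hence lies in \<open>A1\<close>, and its
    image under \<open>h\<close> lies in \<open>A2\<close>, which is disjoint from
    \<open>S2\<close>.\<close>
  have U2S: "U2 \<inter> S2 = {}"
  proof (rule ccontr)
    assume "U2 \<inter> S2 \<noteq> {}"
    then obtain p where p: "p \<in> U2" "p \<in> S2" by blast
    then obtain k where k: "k \<ge> 1" "(f2 ^^ k) p = p" using S(8) unfolding periodic_point_def by blast
    have "h' ((f2 ^^ k) p) = (f1 ^^ k) (h' p)"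
      using U2f eq2 p(1) by (rule conjugacy_iterate)
    then have "periodic_point f1 (h' p)" using k unfolding periodic_point_def by metis
    then have "h' p \<in> A1" using S(9) U1(1,4) U2h(1)[OF p(1)] openin_subset by blast
    then have "p \<in> A2" using U2h(2)[OF p(1)] h(2) by (metis imageI)
    then show False using p S(7) by blast
  qed
  have ab2: "\<exists>k. (f2 ^^ k) x \<in> U2" if "x \<in> ?D2" for x
    using A(2) U2(1) A2U2 that unfolding attractor_dual_to_def by metis
  have c1: "continuous_map (subtopology X U1) X h"
    using hD(1) U1(3) continuous_map_from_subtopology_mono continuous_map_in_subtopology by blast
  have c2: "continuous_map (subtopology X U2) X h'"
    using hD(2) U2(2) continuous_map_from_subtopology_mono continuous_map_in_subtopology by blast
  obtain K where K: "continuous_map (subtopology X ?D1) X K"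
    "\<And>x k. x \<in> ?D1 \<Longrightarrow> (f1 ^^ k) x \<in> U1 \<Longrightarrow> K x = (g2 ^^ k) (h ((f1 ^^ k) x))"
    using glue_conjugacy[OF f1 f2 U1(1,5) c1 eq1 ab1] by blast
  obtain K' where K': "continuous_map (subtopology X ?D2) X K'"
    "\<And>x k. x \<in> ?D2 \<Longrightarrow> (f2 ^^ k) x \<in> U2 \<Longrightarrow> K' x = (g1 ^^ k) (h' ((f2 ^^ k) x))"
    using glue_conjugacy[OF f2 f1 U2(1) U2f c2 eq2 ab2] by blast
  note F1 = homeomorphic_mapsD[OF homeomorphic_maps_funpow[OF f1]]
  note F2 = homeomorphic_mapsD[OF homeomorphic_maps_funpow[OF f2]]
  have "f1 x \<in> S1" if "x \<in> S1" for x using that S(3) by blast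
  then have fS1: "(f1 ^^ k) x \<in> S1" if "x \<in> S1" for x k using that by (intro funpow_in) auto
  have "f2 x \<in> S2" if "x \<in> S2" for x using that S(6) by blast
  then have fS2: "(f2 ^^ k) x \<in> S2" if "x \<in> S2" for x k using that by (intro funpow_in) auto
  have UX: "U1 \<subseteq> topspace X" "U2 \<subseteq> topspace X" using U1(1) U2(1) openin_subset by auto
  \<comment> \<open>An entry time \<open>k\<close> of \<open>x\<close> for \<open>f1\<close> is also
    an entry time of \<open>K x\<close> for \<open>f2\<close>, so \<open>K'\<close> may be evaluated
    with the same \<open>k\<close> and undoes \<open>K\<close>.\<close>
  have KK: "K x \<in> ?D2 \<and> K' (K x) = x" if x: "x \<in> ?D1" for x
  proof -
    obtain k where k: "(f1 ^^ k) x \<in> U1" using ab1 x by blast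
    define y where "y = h ((f1 ^^ k) x)"
    have y: "y \<in> U2" using k by (auto simp: y_def U2_def)
    have Kx: "K x = (g2 ^^ k) y" using K(2)[OF x k] by (simp add: y_def)
    have yX: "y \<in> topspace X" using y UX by blast
    have fK: "(f2 ^^ k) (K x) = y" using F2(6)[OF yX] Kx by simp
    have D2: "K x \<in> ?D2"
      using fS2[of "K x" k] fK y U2S F2(4)[OF yX, of k] Kx by auto
    have "K' (K x) = (g1 ^^ k) (h' y)" using K'(2)[OF D2, of k] fK y by simp
    also have "h' y = (f1 ^^ k) x" using inv1[OF k] by (simp add: y_def)
    finally show ?thesis using D2 F1(5)[of x k] x by simp
  qed
  have KK': "K' x \<in> ?D1 \<and> K (K' x) = x" if x: "x \<in> ?D2" for x
  proof -
    obtain k where k: "(f2 ^^ k) x \<in> U2" using ab2 x by blast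
    define y where "y = h' ((f2 ^^ k) x)"
    have y: "y \<in> U1" using U2h(1)[OF k] by (simp add: y_def)
    have Kx: "K' x = (g1 ^^ k) y" using K'(2)[OF x k] by (simp add: y_def)
    have yX: "y \<in> topspace X" using y UX by blast
    have fK: "(f1 ^^ k) (K' x) = y" using F1(6)[OF yX] Kx by simp
    have D1: "K' x \<in> ?D1"
      using fS1[of "K' x" k] fK y U1(4) F1(4)[OF yX, of k] Kx by auto
    have "K (K' x) = (g2 ^^ k) (h y)" using K(2)[OF D1, of k] fK y by simp
    also have "h y = (f2 ^^ k) x" using U2h(2)[OF k] by (simp add: y_def)
    finally show ?thesis using D1 F2(5)[of x k] x by simp
  qed
  have "homeomorphic_maps (subtopology X ?D1) (subtopology X ?D2) K K'"
    using K(1) K'(1) KK KK' by (auto simp: homeomorphic_maps_def continuous_map_in_subtopology)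
  then obtain H where H: "homeomorphic_map X X H" "\<And>x. x \<in> ?D1 \<Longrightarrow> H x = K x"
    using homeomorphism_extension_off_finite[OF X S(1,2,4,5)] by metis
  \<comment> \<open>Forward invariance of \<open>U1\<close> makes an entry time of \<open>x\<close>
    an entry time of \<open>f1 x\<close>, so both sides are computed with one
    \<open>k\<close>.\<close>
  have Kf: "K (f1 x) = f2 (K x)" "f1 x \<in> ?D1" if x: "x \<in> ?D1" for x
  proof -
    obtain k where k: "(f1 ^^ k) x \<in> U1" using ab1 x by blast
    have f1x: "f1 x \<in> topspace X" using homeomorphic_mapsD(3)[OF f1] x by blast
    show D1: "f1 x \<in> ?D1"
    proof (rule ccontr)
      assume "\<not> ?thesis"
      then obtain y where "y \<in> S1" "f1 x = f1 y" using f1x S(3) by force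
      then have "x = y" using homeomorphic_mapsD(5)[OF f1] x S(2) by (metis Diff_iff subsetD)
      then show False using \<open>y \<in> S1\<close> x by blast
    qed
    have sw: "(f1 ^^ k) (f1 x) = f1 ((f1 ^^ k) x)" by (simp add: funpow_swap1)
    then have "(f1 ^^ k) (f1 x) \<in> U1" using k U1(5) by auto
    from K(2)[OF D1 this] have "K (f1 x) = (g2 ^^ k) (h (f1 ((f1 ^^ k) x)))" unfolding sw .
    also have "\<dots> = (g2 ^^ k) (f2 (h ((f1 ^^ k) x)))" using eq1[OF k] by simp
    also have "h ((f1 ^^ k) x) = (f2 ^^ k) (K x)"
    proof -
      have "h ((f1 ^^ k) x) \<in> topspace X" using k UX by (auto simp: U2_def)
      then show ?thesis using K(2)[OF x k] F2(6) by simp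
    qed
    also have "f2 ((f2 ^^ k) (K x)) = (f2 ^^ k) (f2 (K x))" by (simp add: funpow_swap1)
    also have "(g2 ^^ k) \<dots> = f2 (K x)"
      using F2(5) homeomorphic_mapsD(3)[OF f2] KK[OF x] by blast
    finally show "K (f1 x) = f2 (K x)" .
  qed
  have Hc: "continuous_map X X H" using H(1) homeomorphic_imp_continuous_map by blast
  have "H (f1 x) = f2 (H x)" if "x \<in> topspace X" for x
  proof -
    have "(H \<circ> f1) x = (f2 \<circ> H) x"
    proof (rule forall_in_closure_of_eq[where f = "H \<circ> f1" and g = "f2 \<circ> H" and X = X and Y = X and S = ?D1])
      show "x \<in> X closure_of ?D1" using that closure_of_Diff_finite[OF X(3,2) S(1)] by simp
      show "continuous_map X X (H \<circ> f1)" "continuous_map X X (f2 \<circ> H)"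
        using Hc homeomorphic_mapsD(1) f1 f2 continuous_map_compose by blast+
      show "(H \<circ> f1) x = (f2 \<circ> H) x" if "x \<in> ?D1" for x
        using H(2)[OF that] H(2)[OF Kf(2)[OF that]] Kf(1)[OF that] by simp
    qed (use X in auto)
    then show ?thesis by simp
  qed
  with H(1) that show ?thesis by blast
qed

text \<open>The given neighbourhoods need not be open, nor need the image of the embedding. Keeping
  the points of an open \<open>O1\<close> that \<open>h\<close> sends into an open
  \<open>O2\<close>, and symmetrically for \<open>h'\<close>, gives open sets that \<open>h\<close>
  and \<open>h'\<close> exchange; openness of \<open>G2\<close> rests on \<open>D2\<close> being a
  neighbourhood of \<open>A2\<close>.\<close>

lemma same_dynamical_embedding_germ:
  assumes emb: "same_dynamical_embedding X f1 A1 X f2 A2" and A: "closedin X A1" "closedin X A2"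
  obtains G1 G2 h h' where "openin X G1" "A1 \<subseteq> G1" "openin X G2"
    "homeomorphic_maps (subtopology X G1) (subtopology X G2) h h'" "h ` A1 = A2"
    "\<And>x. x \<in> G1 \<Longrightarrow> h (f1 x) = f2 (h x)"
proof -
  obtain D1 D2 h where nb: "neighbourhood_of X D1 A1" "neighbourhood_of X D2 A2"
    and h: "embedding_map (subtopology X (D1 \<union> f1 ` D1)) X h" "h ` D1 = D2" "h ` A1 = A2"
    and eq: "\<And>x. x \<in> D1 \<Longrightarrow> h (f1 x) = f2 (h x)"
    using emb A unfolding same_dynamical_embedding_def by (auto simp: closure_of_closedin)
  obtain O1 O2 where O1: "openin X O1" "A1 \<subseteq> O1" "O1 \<subseteq> D1" "D1 \<subseteq> topspace X"
    and O2: "openin X O2" "A2 \<subseteq> O2" "O2 \<subseteq> D2"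
    using nb unfolding neighbourhood_of_def by blast
  \<comment> \<open>Nothing here confines the image of \<open>D1\<close> under \<open>f1\<close> to
    the space, and \<open>subtopology\<close> ignores points outside it; \<open>E\<close> is the
    actual carrier.\<close>
  define E where "E = topspace X \<inter> (D1 \<union> f1 ` D1)"
  have DE: "D1 \<subseteq> E" using O1 by (auto simp: E_def)
  have "homeomorphic_map (subtopology X (D1 \<union> f1 ` D1)) (subtopology X (h ` E)) h"
    using h(1) by (simp add: embedding_map_def E_def)
  then obtain h' where "homeomorphic_maps (subtopology X (D1 \<union> f1 ` D1)) (subtopology X (h ` E)) h h'"
    using homeomorphic_map_maps by blast
  then have hm: "homeomorphic_maps (subtopology X E) (subtopology X (h ` E)) h h'"
    unfolding E_def by (metis subtopology_restrict)
  have EX: "topspace (subtopology X E) = E" by (auto simp: E_def)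
  define G1 where "G1 = {x \<in> O1. h x \<in> O2}"
  define G2 where "G2 = {y \<in> O2. h' y \<in> O1}"
  have hE: "h ` E \<subseteq> topspace X"
    using homeomorphic_mapsD(1)[OF hm] EX unfolding continuous_map_in_subtopology continuous_map_def
    by auto
  have hEX: "topspace (subtopology X (h ` E)) = h ` E" using hE by auto
  note hD = homeomorphic_mapsD[OF hm, unfolded EX hEX]
  have O1E: "O1 \<subseteq> E" using O1 DE by blast
  have O2E: "O2 \<subseteq> h ` E" using O2(3) h(2) DE by blast
  have c1: "continuous_map (subtopology X O1) X h"
    using hD(1) O1E continuous_map_from_subtopology_mono continuous_map_in_subtopology by blast
  have c2: "continuous_map (subtopology X O2) X h'"
    using hD(2) O2E continuous_map_from_subtopology_mono continuous_map_in_subtopology by blast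
  have OX: "O1 \<subseteq> topspace X" "O2 \<subseteq> topspace X" using O1(1) O2(1) openin_subset by auto
  have "openin (subtopology X O1) {x \<in> topspace (subtopology X O1). h x \<in> O2}"
    using c1 O2(1) by (rule openin_continuous_map_preimage)
  then have G1: "openin X G1"
    using OX(1) openin_trans_full[OF _ O1(1)] by (simp add: G1_def Int_absorb1)
  have "openin (subtopology X O2) {x \<in> topspace (subtopology X O2). h' x \<in> O1}"
    using c2 O1(1) by (rule openin_continuous_map_preimage)
  then have G2: "openin X G2"
    using OX(2) openin_trans_full[OF _ O2(1)] by (simp add: G2_def Int_absorb1)
  have G1O: "G1 \<subseteq> O1" and G2O: "G2 \<subseteq> O2" by (auto simp: G1_def G2_def)
  have m: "h x \<in> G2" "h' (h x) = x" if "x \<in> G1" for x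
  proof -
    have "x \<in> E" using that G1O O1E by blast
    then show "h' (h x) = x" using hD(5) by blast
    then show "h x \<in> G2" using that by (auto simp: G1_def G2_def)
  qed
  have m': "h' y \<in> G1" "h (h' y) = y" if "y \<in> G2" for y
  proof -
    have "y \<in> h ` E" using that G2O O2E by blast
    then show "h (h' y) = y" using hD(6) by blast
    then show "h' y \<in> G1" using that by (auto simp: G1_def G2_def)
  qed
  have "homeomorphic_maps (subtopology X G1) (subtopology X G2) h h'"
    using m m' continuous_map_from_subtopology_mono[OF c1 G1O]
      continuous_map_from_subtopology_mono[OF c2 G2O]
    by (auto simp: homeomorphic_maps_def continuous_map_in_subtopology)
  moreover have "A1 \<subseteq> G1" using O1(2) O2(2) h(3) by (auto simp: G1_def)
  moreover have "h (f1 x) = f2 (h x)" if "x \<in> G1" for x using that G1O O1(3) eq by blast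
  ultimately show ?thesis using that[OF G1 _ G2 _ h(3)] by blast
qed

section \<open>Homeomorphisms with finite non-wandering set\<close>

lemma compact_space_nat_cover:
  fixes U :: "nat \<Rightarrow> 'a set"
  assumes "compact_space X" "closedin X C" "\<And>n. openin X (U n)" "C \<subseteq> (\<Union>n. U n)"
  obtains m where "C \<subseteq> (\<Union>k\<le>m. U k)"
proof -
  have "compactin X C" using assms(1,2) closedin_compact_space by blast
  moreover have "\<forall>V\<in>range U. openin X V" using assms(3) by blast
  ultimately obtain \<F> where "finite \<F>" "\<F> \<subseteq> range U" "C \<subseteq> \<Union>\<F>"
    using assms(4) unfolding compactin_def by metis
  then obtain I where I: "finite I" "C \<subseteq> (\<Union>k\<in>I. U k)" by (metis finite_subset_image)
  then have "I \<subseteq> {..Max I}" by auto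
  then show ?thesis using I(2) that[of "Max I"] by blast
qed

lemma nonwandering_inverse_subset:
  assumes "homeomorphic_maps X X f g"
  shows "nonwandering X f \<subseteq> nonwandering X g"
proof
  fix x assume x: "x \<in> nonwandering X f"
  have "\<exists>k\<ge>1. (g ^^ k) ` U \<inter> U \<noteq> {}" if U: "openin X U" "x \<in> U" for U
  proof -
    obtain k y where k: "k \<ge> 1" "y \<in> U" "(f ^^ k) y \<in> U" using x U unfolding nonwandering_def by blast
    have "y \<in> topspace X" using k(2) U(1) openin_subset by blast
    then have "(g ^^ k) ((f ^^ k) y) = y"
      using homeomorphic_mapsD(5)[OF homeomorphic_maps_funpow[OF assms]] by blast
    then have "y \<in> (g ^^ k) ` U" using k(3) by (metis imageI)
    then show ?thesis using k by blast
  qed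
  then show "x \<in> nonwandering X g" using x unfolding nonwandering_def by blast
qed

lemma nonwandering_inverse:
  assumes "homeomorphic_maps X X f g"
  shows "nonwandering X g = nonwandering X f"
  using nonwandering_inverse_subset assms homeomorphic_maps_sym by blast

lemma nonwandering_forward:
  assumes f: "continuous_map X X f" and x: "x \<in> nonwandering X f"
  shows "f x \<in> nonwandering X f"
proof -
  have xX: "x \<in> topspace X" using x by (simp add: nonwandering_def)
  have "\<exists>k\<ge>1. (f ^^ k) ` U \<inter> U \<noteq> {}" if U: "openin X U" "f x \<in> U" for U
  proof -
    have "openin X {y \<in> topspace X. f y \<in> U}" using f U(1) by (rule openin_continuous_map_preimage)
    moreover have "x \<in> {y \<in> topspace X. f y \<in> U}" using xX U by blast
    ultimately obtain k y where k: "k \<ge> 1" "f y \<in> U" "f ((f ^^ k) y) \<in> U"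
      using x unfolding nonwandering_def by blast
    then have "(f ^^ k) (f y) \<in> U" by (simp add: funpow_swap1)
    then show ?thesis using k by blast
  qed
  moreover have "f x \<in> topspace X" using f xX by (auto simp: continuous_map_def)
  ultimately show ?thesis unfolding nonwandering_def by blast
qed

lemma periodic_point_finite_invariant:
  assumes "inj_on f S" "finite S" "f ` S \<subseteq> S" "x \<in> S"
  shows "periodic_point f x"
proof -
  have S: "(f ^^ k) y \<in> S" if "y \<in> S" for k y using assms(3) that by (intro funpow_in) auto
  then have "range (\<lambda>k. (f ^^ k) x) \<subseteq> S" using assms(4) by blast
  then have "finite (range (\<lambda>k. (f ^^ k) x))" using assms(2) finite_subset by blast
  then have "\<not> inj (\<lambda>k. (f ^^ k) x)" using finite_imageD infinite_UNIV_nat by blast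
  then obtain i j where "i < j" "(f ^^ i) x = (f ^^ j) x"
    unfolding inj_def by (metis linorder_neqE_nat)
  then have "(f ^^ i) ((f ^^ (j - i)) x) = (f ^^ i) x"
    by (metis funpow_add le_add_diff_inverse less_imp_le comp_apply)
  moreover have "y = z" if "y \<in> S" "z \<in> S" "(f ^^ i) y = (f ^^ i) z" for i y z
    using that(3)
  proof (induction i)
    case (Suc i)
    then have "f ((f ^^ i) y) = f ((f ^^ i) z)" by simp
    then show ?case using Suc.IH inj_onD[OF assms(1) _ S[OF that(1)] S[OF that(2)]] by blast
  qed simp
  ultimately have "(f ^^ (j - i)) x = x" using S[OF assms(4)] assms(4) by blast
  moreover have "j - i \<ge> 1" using \<open>i < j\<close> by simp
  ultimately show ?thesis unfolding periodic_point_def by blast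
qed

section \<open>Asymptotics of orbits when the non-wandering set is finite\<close>

definition asymptotic :: "('a \<Rightarrow> 'a \<Rightarrow> real) \<Rightarrow> ('a \<Rightarrow> 'a) \<Rightarrow> 'a \<Rightarrow> 'a \<Rightarrow> bool" where
  "asymptotic d f x y \<longleftrightarrow> (\<lambda>k. d ((f ^^ k) x) ((f ^^ k) y)) \<longlonglongrightarrow> 0"

lemma stable_set_iff: "y \<in> stable_set X d f P \<longleftrightarrow> y \<in> topspace X \<and> (\<exists>x\<in>P. asymptotic d f x y)"
  by (auto simp: stable_set_def asymptotic_def)

text \<open>Carrying the inverse \<open>g\<close> as a parameter makes time reversal an
  interpretation (\<open>reversed\<close>): unstable sets of \<open>f\<close> are stable sets of
  \<open>g\<close>.\<close>

locale finite_nonwandering =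
  fixes X :: "'a topology" and d :: "'a \<Rightarrow> 'a \<Rightarrow> real" and f g :: "'a \<Rightarrow> 'a"
  assumes metric: "metric_on X d" and compact: "compact_space X"
    and hom: "homeomorphic_maps X X f g" and finite_N: "finite (nonwandering X f)"
begin

abbreviation "N \<equiv> nonwandering X f"

sublocale Metric_space "topspace X" d
  using metric by (simp add: metric_on_def)

lemma mtopology: "mtopology = X"
  using metric by (simp add: metric_on_def)

lemma Hausdorff: "Hausdorff_space X"
  using Hausdorff_space_mtopology mtopology by simp

lemma reversed: "finite_nonwandering X d g f"
  using metric compact hom finite_N homeomorphic_maps_sym nonwandering_inverse[OF hom]
  by (auto simp: finite_nonwandering_def)

lemma N_subset: "N \<subseteq> topspace X"
  by (auto simp: nonwandering_def)

lemma f_N: "f ` N = N"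
proof
  show "f ` N \<subseteq> N" using nonwandering_forward[OF homeomorphic_mapsD(1)[OF hom]] by (rule image_subsetI)
  show "N \<subseteq> f ` N"
  proof
    fix x assume x: "x \<in> N"
    have "g x \<in> N"
      using nonwandering_forward[OF homeomorphic_mapsD(2)[OF hom], of x] x
      unfolding nonwandering_inverse[OF hom] .
    moreover have "f (g x) = x" using homeomorphic_mapsD(6)[OF hom] N_subset x by blast
    ultimately show "x \<in> f ` N" by force
  qed
qed

lemma complement_invariant:
  assumes "S \<subseteq> N" "f ` S = S"
  shows "f ` (N - S) \<subseteq> N - S"
proof -
  have "inj_on f N" using homeomorphic_mapsD(5)[OF hom] N_subset by (metis inj_on_inverseI subsetD)
  then have "f ` (N - S) = f ` N - f ` S" using assms(1) by (intro inj_on_image_set_diff) auto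
  then show ?thesis using f_N assms(2) by simp
qed

lemma iterate_in: "x \<in> topspace X \<Longrightarrow> (f ^^ k) x \<in> topspace X"
  using homeomorphic_mapsD(3)[OF homeomorphic_maps_funpow[OF hom]] .

text \<open>A wandering point has an open neighbourhood that every orbit visits at most once.
  Finitely many of these cover the compact complement of \<open>U\<close>, so the orbit is there
  only finitely often.\<close>

lemma eventually_near_N:
  assumes x: "x \<in> topspace X" and U: "openin X U" "N \<subseteq> U"
  obtains K where "\<And>k. k \<ge> K \<Longrightarrow> (f ^^ k) x \<in> U"
proof -
  define C where "C = topspace X - U"
  have C: "compactin X C" unfolding C_def using U(1) compact closedin_compact_space by blast
  have "\<exists>V. openin X V \<and> y \<in> V \<and> (\<forall>k\<ge>1. (f ^^ k) ` V \<inter> V = {})" if "y \<in> C" for y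
  proof -
    have "y \<in> topspace X - N" using that U(2) unfolding C_def by blast
    then show ?thesis unfolding nonwandering_def by blast
  qed
  then obtain V where V: "\<And>y. y \<in> C \<Longrightarrow> openin X (V y) \<and> y \<in> V y"
      "\<And>y k. y \<in> C \<Longrightarrow> k \<ge> 1 \<Longrightarrow> (f ^^ k) ` V y \<inter> V y = {}" by metis
  have once: "i = j" if y: "y \<in> C" and ij: "(f ^^ i) x \<in> V y" "(f ^^ j) x \<in> V y" for y i j
  proof -
    have less: False if ij: "i < j" "(f ^^ i) x \<in> V y" "(f ^^ j) x \<in> V y" for i j
    proof -
      have "(f ^^ j) x = (f ^^ (j - i)) ((f ^^ i) x)"
        using ij(1) by (metis funpow_add le_add_diff_inverse2 less_imp_le comp_apply)
      then have "(f ^^ j) x \<in> (f ^^ (j - i)) ` V y \<inter> V y" using ij by blast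
      then show False using V(2)[OF y, of "j - i"] ij(1) by auto
    qed
    then show ?thesis using ij by (metis linorder_neqE_nat)
  qed
  have "\<forall>W\<in>V ` C. openin X W" "C \<subseteq> \<Union>(V ` C)" using V(1) by blast+
  then obtain \<F> where "finite \<F>" "\<F> \<subseteq> V ` C" "C \<subseteq> \<Union>\<F>"
    using C unfolding compactin_def by metis
  then obtain Y where Y: "finite Y" "Y \<subseteq> C" "C \<subseteq> \<Union>(V ` Y)" by (metis finite_subset_image)
  have "{k. (f ^^ k) x \<in> C} \<subseteq> (\<Union>y\<in>Y. {k. (f ^^ k) x \<in> V y})" using Y by blast
  moreover have "finite {k. (f ^^ k) x \<in> V y}" if "y \<in> Y" for y
  proof (cases "{k. (f ^^ k) x \<in> V y} = {}")
    case False
    then obtain i where "(f ^^ i) x \<in> V y" by blast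
    then have "{k. (f ^^ k) x \<in> V y} \<subseteq> {i}" using once that Y(2) by blast
    then show ?thesis using finite_subset by blast
  qed (metis finite.emptyI)
  ultimately have "finite {k. (f ^^ k) x \<in> C}" using Y(1) finite_subset by blast
  then obtain K where "\<And>k. (f ^^ k) x \<in> C \<Longrightarrow> k < K"
    using finite_nat_set_iff_bounded by auto
  then have "(f ^^ k) x \<in> U" if "k \<ge> K" for k
    using that iterate_in[OF x] unfolding C_def by (meson DiffI leD)
  then show ?thesis using that by blast
qed

text \<open>Once the orbit stays near \<open>N\<close>, continuity dictates which point of
  \<open>N\<close> it is close to at the next step, so it follows a single orbit of
  \<open>N\<close>.\<close>

lemma asymptotic_exists:
  assumes x: "x \<in> topspace X"
  obtains q where "q \<in> N" "asymptotic d f q x"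
proof -
  obtain V where V: "\<And>q. q \<in> N \<Longrightarrow> openin X (V q) \<and> q \<in> V q"
    and disj: "\<And>q r. q \<in> N \<Longrightarrow> r \<in> N \<Longrightarrow> q \<noteq> r \<Longrightarrow> V q \<inter> V r = {}"
    using Hausdorff_disjoint_nbhds_finite[OF Hausdorff finite_N N_subset] by metis
  have fN: "f q \<in> N" if "q \<in> N" for q using f_N that by blast
  \<comment> \<open>Points of \<open>W q\<close> are sent by \<open>f\<close> into
    \<open>V (f q)\<close>. As the sets \<open>V\<close> are disjoint, the only \<open>W r\<close>
    that can contain the image is the one with \<open>r = f q\<close>.\<close>
  define W where "W q = V q \<inter> {y \<in> topspace X. f y \<in> V (f q)}" for q
  have W: "openin X (W q)" "q \<in> W q" if q: "q \<in> N" for q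
  proof -
    have "openin X {y \<in> topspace X. f y \<in> V (f q)}"
      using homeomorphic_mapsD(1)[OF hom] V[OF fN[OF q]] openin_continuous_map_preimage by blast
    then show "openin X (W q)" using V[OF q] by (auto simp: W_def)
    show "q \<in> W q" using V[OF q] V[OF fN[OF q]] N_subset q by (auto simp: W_def)
  qed
  have "openin X (\<Union>q\<in>N. W q)" "N \<subseteq> (\<Union>q\<in>N. W q)" using W by auto
  then obtain K where K: "\<And>k. k \<ge> K \<Longrightarrow> (f ^^ k) x \<in> (\<Union>q\<in>N. W q)"
    using eventually_near_N[OF x] by metis
  obtain p where p: "p \<in> N" "(f ^^ K) x \<in> W p" using K[of K] by blast
  have fp: "(f ^^ j) p \<in> N" for j using fN p(1) by (rule funpow_in)
  have track: "(f ^^ (K + j)) x \<in> W ((f ^^ j) p)" for j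
  proof (induction j)
    case (Suc j)
    have 1: "(f ^^ (K + Suc j)) x \<in> V ((f ^^ Suc j) p)" using Suc by (simp add: W_def)
    obtain r where r: "r \<in> N" "(f ^^ (K + Suc j)) x \<in> W r" using K[of "K + Suc j"] by auto
    have "r = (f ^^ Suc j) p"
    proof (rule ccontr)
      assume "\<not> ?thesis"
      then have "V r \<inter> V ((f ^^ Suc j) p) = {}" using disj r(1) fp by blast
      then show False using 1 r(2) unfolding W_def by blast
    qed
    then show ?case using r(2) by simp
  qed (use p in simp)
  \<comment> \<open>\<open>p\<close> is followed from time \<open>K\<close> on; pulling it back by
    \<open>K\<close> steps gives the right phase at time 0.\<close>
  define q where "q = (g ^^ K) p"
  have fq: "(f ^^ (K + j)) q = (f ^^ j) p" for j
  proof -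
    have "(f ^^ (K + j)) q = (f ^^ j) ((f ^^ K) q)" by (simp add: funpow_add add.commute[of K])
    then show ?thesis
      using homeomorphic_mapsD(6)[OF homeomorphic_maps_funpow[OF hom], of p K] N_subset p(1)
      by (auto simp: q_def)
  qed
  have gN: "g ` N = N" using homeomorphic_maps_invariant_swap[OF hom N_subset f_N] .
  then have "g y \<in> N" if "y \<in> N" for y using that by blast
  then have qN: "q \<in> N" unfolding q_def using p(1) by (rule funpow_in)
  have "asymptotic d f q x"
    unfolding asymptotic_def
  proof (rule LIMSEQ_I)
    fix e :: real assume e: "0 < e"
    \<comment> \<open>The ball controls the distance, while the factor \<open>W r\<close> allows
      \<open>track\<close> to identify \<open>r\<close> as the current point of the followed
      orbit.\<close>
    define Z where "Z r = W r \<inter> mball r e" for r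
    have "openin X (\<Union>r\<in>N. Z r)"
      using W(1) openin_mball unfolding mtopology Z_def by (intro openin_Union) auto
    moreover have "N \<subseteq> (\<Union>r\<in>N. Z r)" using W(2) e N_subset by (auto simp: Z_def)
    ultimately obtain L where L: "\<And>k. k \<ge> L \<Longrightarrow> (f ^^ k) x \<in> (\<Union>r\<in>N. Z r)"
      using eventually_near_N[OF x] by metis
    have "d ((f ^^ k) q) ((f ^^ k) x) < e" if k: "k \<ge> max K L" for k
    proof -
      obtain j where j: "k = K + j" using k le_Suc_ex[of K k] by auto
      obtain r where r: "r \<in> N" "(f ^^ k) x \<in> Z r" using L[of k] k by auto
      have "r = (f ^^ j) p"
      proof (rule ccontr)
        assume "\<not> ?thesis"
        then have "V r \<inter> V ((f ^^ j) p) = {}" using disj r(1) fp by blast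
        then show False using r(2) track[of j] unfolding W_def Z_def j by blast
      qed
      then show ?thesis using r(2) fq[of j] by (auto simp: Z_def j)
    qed
    then show "\<exists>no. \<forall>k\<ge>no. norm (d ((f ^^ k) q) ((f ^^ k) x) - 0) < e"
      by (intro exI[of _ "max K L"]) auto
  qed
  then show ?thesis using that qN by blast
qed

text \<open>The point of \<open>Q\<close> being approached moves with time; finiteness of
  \<open>Q\<close> provides one radius that fits into \<open>G\<close> at all of its points.\<close>

lemma asymptotic_eventually:
  assumes x: "x \<in> topspace X" and Q: "q \<in> Q" "Q \<subseteq> N" "f ` Q \<subseteq> Q" and G: "openin X G" "Q \<subseteq> G"
    and as: "asymptotic d f q x"
  obtains K where "\<And>k. k \<ge> K \<Longrightarrow> (f ^^ k) x \<in> G"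
proof -
  have fin: "finite Q" using Q(2) finite_N finite_subset by blast
  have "\<exists>r>0. mball p r \<subseteq> G" if "p \<in> Q" for p
    using G that openin_mtopology[of G] unfolding mtopology by blast
  then obtain r where r: "\<And>p. p \<in> Q \<Longrightarrow> r p > 0 \<and> mball p (r p) \<subseteq> G" by metis
  define e where "e = Min (r ` Q)"
  have e: "e > 0" unfolding e_def using fin Q(1) r by (subst Min_gr_iff) auto
  have er: "e \<le> r p" if "p \<in> Q" for p unfolding e_def using fin that by simp
  obtain K where K: "\<And>k. k \<ge> K \<Longrightarrow> norm (d ((f ^^ k) q) ((f ^^ k) x) - 0) < e"
    using LIMSEQ_D[OF as[unfolded asymptotic_def] e] by blast
  have "(f ^^ k) x \<in> G" if k: "k \<ge> K" for k
  proof -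
    have q: "(f ^^ k) q \<in> Q" using Q by (intro funpow_in) auto
    have "d ((f ^^ k) q) ((f ^^ k) x) < r ((f ^^ k) q)" using K[OF k] er[OF q] by simp
    then have "(f ^^ k) x \<in> mball ((f ^^ k) q) (r ((f ^^ k) q))"
      using q Q(2) N_subset iterate_in[OF x] by auto
    then show ?thesis using r[OF q] by blast
  qed
  then show ?thesis using that by blast
qed

text \<open>The points of \<open>N\<close> have disjoint neighbourhoods containing balls of one
  common radius, so \<open>x\<close> cannot follow two orbits that differ at the same large time.
  Injectivity of the iterates carries the coincidence back to time 0.\<close>

lemma asymptotic_unique:
  assumes x: "x \<in> topspace X" and q: "q \<in> N" "r \<in> N" "asymptotic d f q x" "asymptotic d f r x"
  shows "q = r"
proof -
  obtain V where V: "\<And>q. q \<in> N \<Longrightarrow> openin X (V q) \<and> q \<in> V q"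
    and disj: "\<And>q r. q \<in> N \<Longrightarrow> r \<in> N \<Longrightarrow> q \<noteq> r \<Longrightarrow> V q \<inter> V r = {}"
    using Hausdorff_disjoint_nbhds_finite[OF Hausdorff finite_N N_subset] by metis
  have "\<exists>e>0. mball p e \<subseteq> V p" if "p \<in> N" for p
    using V[OF that] openin_mtopology[of "V p"] unfolding mtopology by blast
  then obtain e where e: "\<And>p. p \<in> N \<Longrightarrow> e p > 0 \<and> mball p (e p) \<subseteq> V p" by metis
  define m where "m = Min (e ` N)"
  have m: "m > 0" unfolding m_def using finite_N q(1) e by (subst Min_gr_iff) auto
  have me: "m \<le> e p" if "p \<in> N" for p unfolding m_def using finite_N that by simp
  have near: "\<exists>K. \<forall>k\<ge>K. (f ^^ k) x \<in> V ((f ^^ k) p)" if p: "p \<in> N" "asymptotic d f p x" for p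
  proof -
    obtain K where K: "\<And>k. k \<ge> K \<Longrightarrow> norm (d ((f ^^ k) p) ((f ^^ k) x) - 0) < m"
      using LIMSEQ_D[OF p(2)[unfolded asymptotic_def] m] by blast
    have "(f ^^ k) x \<in> V ((f ^^ k) p)" if k: "k \<ge> K" for k
    proof -
      have pk: "(f ^^ k) p \<in> N" using f_N p(1) by (intro funpow_in) auto
      have "d ((f ^^ k) p) ((f ^^ k) x) < e ((f ^^ k) p)" using K[OF k] me[OF pk] by simp
      then have "(f ^^ k) x \<in> mball ((f ^^ k) p) (e ((f ^^ k) p))"
        using pk N_subset iterate_in[OF x] by auto
      then show ?thesis using e[OF pk] by blast
    qed
    then show ?thesis by blast
  qed
  obtain K L where K: "\<And>k. k \<ge> K \<Longrightarrow> (f ^^ k) x \<in> V ((f ^^ k) q)"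
      and L: "\<And>k. k \<ge> L \<Longrightarrow> (f ^^ k) x \<in> V ((f ^^ k) r)"
    using near q by metis
  define k where "k = max K L"
  have N: "(f ^^ k) q \<in> N" "(f ^^ k) r \<in> N" using f_N q by (auto intro!: funpow_in)
  have "(f ^^ k) q = (f ^^ k) r"
  proof (rule ccontr)
    assume "\<not> ?thesis"
    then have "V ((f ^^ k) q) \<inter> V ((f ^^ k) r) = {}" using disj N by blast
    then show False using K[of k] L[of k] unfolding k_def by auto
  qed
  then show ?thesis
    using homeomorphic_mapsD(5)[OF homeomorphic_maps_funpow[OF hom], of _ k] q N_subset by (metis subsetD)
qed

section \<open>Stable sets, repellers and their dual attractors\<close>

lemma subset_stable_set: "P \<subseteq> topspace X \<Longrightarrow> P \<subseteq> stable_set X d f P"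
proof
  fix x assume x: "P \<subseteq> topspace X" "x \<in> P"
  then have "asymptotic d f x x" using iterate_in[of x] by (auto simp: asymptotic_def)
  then show "x \<in> stable_set X d f P" using x by (auto simp: stable_set_iff)
qed

lemma stable_set_disjoint:
  assumes "P \<subseteq> N" "Q \<subseteq> N" "P \<inter> Q = {}"
  shows "stable_set X d f P \<inter> stable_set X d f Q = {}"
proof (rule ccontr)
  assume "\<not> ?thesis"
  then obtain x p q where "x \<in> topspace X" "p \<in> P" "q \<in> Q" "asymptotic d f p x" "asymptotic d f q x"
    by (auto simp: stable_set_iff)
  then show False using asymptotic_unique assms by blast
qed

lemma stable_set_iff_image:
  assumes P: "P \<subseteq> topspace X" "f ` P = P" and x: "x \<in> topspace X"
  shows "f x \<in> stable_set X d f P \<longleftrightarrow> x \<in> stable_set X d f P"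
proof -
  have sh: "asymptotic d f (f p) (f x) \<longleftrightarrow> asymptotic d f p x" for p
  proof -
    have "(\<lambda>k. d ((f ^^ k) (f p)) ((f ^^ k) (f x))) = (\<lambda>k. d ((f ^^ (Suc k)) p) ((f ^^ (Suc k)) x))"
      by (simp add: funpow_swap1)
    then show ?thesis
      unfolding asymptotic_def
      using filterlim_sequentially_Suc[of "\<lambda>k. d ((f ^^ k) p) ((f ^^ k) x)"] by simp
  qed
  have "f x \<in> topspace X" using iterate_in[OF x, of 1] by simp
  moreover have "(\<exists>q\<in>P. asymptotic d f q (f x)) \<longleftrightarrow> (\<exists>p\<in>P. asymptotic d f p x)"
    using sh P(2) by (metis imageE imageI)
  ultimately show ?thesis using x by (simp add: stable_set_iff)
qed

lemma stable_set_iff_iterate: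
  assumes "P \<subseteq> topspace X" "f ` P = P" "x \<in> topspace X"
  shows "(f ^^ k) x \<in> stable_set X d f P \<longleftrightarrow> x \<in> stable_set X d f P"
  using stable_set_iff_image[OF assms(1,2)] iterate_in[OF assms(3)] by (induction k) auto

text \<open>\<open>W\<close> isolates \<open>S\<close> in the non-wandering set, so only the points of \<open>S\<close> itself stay in \<open>W\<close>
  under forward iteration; by compactness the points that stay in \<open>W\<close> for a bounded time
  already form a small neighbourhood \<open>B\<close> of \<open>S\<close>, which is invariant under \<open>g\<close>.\<close>

lemma repeller_neighbourhood:
  assumes S: "S \<subseteq> N" "f ` S = S" and st: "stable_set X d f S = S"
  obtains B I where "closedin X B" "openin X I" "S \<subseteq> I" "I \<subseteq> B" "g ` B \<subseteq> B"
    "B \<subseteq> stable_set X d g S"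
proof -
  interpret inv: finite_nonwandering X d g f by (rule reversed)
  have NN: "nonwandering X g = N" using nonwandering_inverse[OF hom] .
  have SX: "S \<subseteq> topspace X" using S(1) N_subset by blast
  have gS: "g ` S = S" using homeomorphic_maps_invariant_swap[OF hom SX S(2)] .
  obtain V where V: "\<And>q. q \<in> N \<Longrightarrow> openin X (V q) \<and> q \<in> V q"
    and disj: "\<And>q r. q \<in> N \<Longrightarrow> r \<in> N \<Longrightarrow> q \<noteq> r \<Longrightarrow> V q \<inter> V r = {}"
    using Hausdorff_disjoint_nbhds_finite[OF Hausdorff finite_N N_subset] by metis
  define E where "E = (\<Union>q\<in>N - S. V q)"
  define O1 where "O1 = (\<Union>q\<in>S. V q)"
  define W where "W = topspace X - E"
  have oE: "openin X E" "openin X O1" unfolding E_def O1_def using V S(1) by blast+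
  have W: "closedin X W" unfolding W_def using oE by blast
  have "O1 \<inter> E = {}" using disj S(1) unfolding E_def O1_def by blast
  then have O1: "S \<subseteq> O1" "O1 \<subseteq> W"
    using V S(1) openin_subset[OF oE(2)] unfolding O1_def W_def by blast+
  have NE: "N - S \<subseteq> E" using V unfolding E_def by blast
  note fNS = complement_invariant[OF S]
  have gNS: "g ` (N - S) \<subseteq> N - S" using inv.complement_invariant[of S] S(1) gS NN by simp
  \<comment> \<open>The assumption \<open>st\<close> enters here: a point that never meets
    \<open>E\<close> is asymptotic to an orbit in \<open>S\<close>, hence lies in the stable set of
    \<open>S\<close>, which is \<open>S\<close> itself.\<close>
  have stay: "x \<in> S" if x: "x \<in> topspace X" "\<And>k. (f ^^ k) x \<in> W" for x
  proof -
    obtain q where q: "q \<in> N" "asymptotic d f q x" using asymptotic_exists[OF x(1)] .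
    have "q \<in> S"
    proof (rule ccontr)
      assume "q \<notin> S"
      then have "q \<in> N - S" using q(1) by blast
      then obtain K where "\<And>k. k \<ge> K \<Longrightarrow> (f ^^ k) x \<in> E"
        using asymptotic_eventually[OF x(1) _ _ fNS oE(1) NE q(2)] by blast
      then show False using x(2)[of K] unfolding W_def by blast
    qed
    then have "x \<in> stable_set X d f S" using q x by (auto simp: stable_set_iff)
    then show ?thesis using st by simp
  qed
  have stay_back: "x \<in> stable_set X d g S" if x: "x \<in> topspace X" "\<And>k. (g ^^ k) x \<in> W" for x
  proof -
    obtain q where q: "q \<in> N" "asymptotic d g q x" using inv.asymptotic_exists[OF x(1)] NN by metis
    have "q \<in> S"
    proof (rule ccontr)
      assume "q \<notin> S"
      then have "q \<in> N - S" using q(1) by blast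
      then obtain K where "\<And>k. k \<ge> K \<Longrightarrow> (g ^^ k) x \<in> E"
        using inv.asymptotic_eventually[OF x(1) _ _ gNS oE(1) NE q(2)] NN by blast
      then show False using x(2)[of K] unfolding W_def by blast
    qed
    then show ?thesis using q x by (auto simp: stable_set_iff)
  qed
  define D where "D n = {x \<in> topspace X. (f ^^ n) x \<in> W}" for n
  have cD: "closedin X (D n)" for n
    unfolding D_def using homeomorphic_mapsD(1)[OF homeomorphic_maps_funpow[OF hom]] W
    by (rule closedin_continuous_map_preimage)
  \<comment> \<open>The condition on \<open>g x\<close> prepares the invariance of \<open>B\<close>:
    requirements on \<open>g x\<close> at positive times are those on \<open>x\<close> one step
    earlier, so only time 0 needs an extra argument.\<close>
  define O2 where "O2 = O1 \<inter> {x \<in> topspace X. g x \<in> O1}"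
  have oO2: "openin X O2" unfolding O2_def
    using oE(2) openin_continuous_map_preimage[OF homeomorphic_mapsD(2)[OF hom] oE(2)] by blast
  have "topspace X - O2 \<subseteq> (\<Union>n. topspace X - D n)"
  proof
    fix x assume x: "x \<in> topspace X - O2"
    have "S \<subseteq> O2" using O1(1) gS SX unfolding O2_def by blast
    then have "x \<notin> S" using x by blast
    then show "x \<in> (\<Union>n. topspace X - D n)" using stay x unfolding D_def by blast
  qed
  moreover have "closedin X (topspace X - O2)" using oO2 by blast
  moreover have "openin X (topspace X - D n)" for n using cD by blast
  \<comment> \<open>Points outside \<open>O2\<close> are not in \<open>S\<close>, so each of them
    leaves \<open>W\<close> at some time; compactness bounds a first such time by
    \<open>n\<close>.\<close>
  ultimately obtain n where n: "topspace X - O2 \<subseteq> (\<Union>k\<le>n. topspace X - D k)"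
    using compact_space_nat_cover[OF compact] by metis
  define B where "B = (\<Inter>k\<in>{..n}. D k)"
  \<comment> \<open>Replacing the closed \<open>W\<close> by the open \<open>O1\<close> in the
    conditions for \<open>B\<close> produces an open neighbourhood of \<open>S\<close> inside
    \<open>B\<close>.\<close>
  define I where "I = (\<Inter>k\<in>{..n}. {x \<in> topspace X. (f ^^ k) x \<in> O1})"
  have BD: "x \<in> B \<longleftrightarrow> x \<in> topspace X \<and> (\<forall>k\<le>n. (f ^^ k) x \<in> W)" for x
    unfolding B_def D_def by auto
  have ID: "x \<in> I \<longleftrightarrow> x \<in> topspace X \<and> (\<forall>k\<le>n. (f ^^ k) x \<in> O1)" for x
    unfolding I_def by auto
  have BO2: "B \<subseteq> O2" using n unfolding B_def D_def by blast
  have 1: "closedin X B" unfolding B_def using cD by (intro closedin_Inter) auto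
  have "openin X {x \<in> topspace X. (f ^^ k) x \<in> O1}" for k
    using homeomorphic_mapsD(1)[OF homeomorphic_maps_funpow[OF hom]] oE(2)
    by (rule openin_continuous_map_preimage)
  then have 2: "openin X I" unfolding I_def by (intro openin_Inter) auto
  have fS: "(f ^^ k) x \<in> S" if "x \<in> S" for x k using that S(2) by (intro funpow_in) auto
  have 3: "S \<subseteq> I" using fS O1(1) SX unfolding ID subset_iff by blast
  have 4: "I \<subseteq> B" using O1(2) ID BD by blast
  have gB: "g x \<in> B" if x: "x \<in> B" for x
  proof -
    have xX: "x \<in> topspace X" using x BD by blast
    have gx: "g x \<in> topspace X" using homeomorphic_mapsD(4)[OF hom xX] .
    have "(f ^^ k) (g x) \<in> W" if "k \<le> n" for k
    proof (cases k)
      case 0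
      then show ?thesis using x BO2 O1(2) unfolding O2_def by auto
    next
      case (Suc j)
      have "(f ^^ k) (g x) = (f ^^ j) (f (g x))" by (simp add: Suc funpow_swap1)
      also have "\<dots> = (f ^^ j) x" using homeomorphic_mapsD(6)[OF hom xX] by simp
      finally show ?thesis using x BD that Suc by auto
    qed
    then show ?thesis using gx BD by blast
  qed
  have "x \<in> stable_set X d g S" if x: "x \<in> B" for x
  proof (rule stay_back)
    have "(g ^^ k) x \<in> B" for k using gB x by (rule funpow_in)
    then show "(g ^^ k) x \<in> W" for k using BO2 O1(2) unfolding O2_def by blast
  qed (use x BD in blast)
  then show ?thesis using that[OF 1 2 3 4] gB by blast
qed

text \<open>Since \<open>g\<close> maps \<open>B\<close> into itself, the sets \<open>BB k\<close>
  increase and exhaust the unstable set of \<open>S\<close>; their complements are trapping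
  neighbourhoods of \<open>A\<close>. Absorption comes from \<open>st\<close>: a point outside
  \<open>S\<close> is not in the stable set of \<open>S\<close>, so its forward limit orbit lies in
  \<open>N - S\<close>, a subset of \<open>A\<close>.\<close>

lemma repeller_attractor:
  assumes S: "S \<subseteq> N" "f ` S = S" and st: "stable_set X d f S = S"
  shows "openin X (stable_set X d g S)"
    and "attractor_dual_to X f (topspace X - stable_set X d g S) S"
proof -
  interpret inv: finite_nonwandering X d g f by (rule reversed)
  have NN: "nonwandering X g = N" using nonwandering_inverse[OF hom] .
  have SX: "S \<subseteq> topspace X" using S(1) N_subset by blast
  have gS: "g ` S = S" using homeomorphic_maps_invariant_swap[OF hom SX S(2)] .
  note F = homeomorphic_mapsD[OF hom]
  let ?Wu = "stable_set X d g S"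
  define A where "A = topspace X - ?Wu"
  obtain B I where B: "closedin X B" "openin X I" "S \<subseteq> I" "I \<subseteq> B" "g ` B \<subseteq> B" "B \<subseteq> ?Wu"
    using repeller_neighbourhood[OF assms] by metis
  define II where "II k = {x \<in> topspace X. (g ^^ k) x \<in> I}" for k
  \<comment> \<open>The open sets \<open>II k\<close> serve for coverings, the closed sets
    \<open>BB k\<close> for complements that have to be open.\<close>
  define BB where "BB k = {x \<in> topspace X. (g ^^ k) x \<in> B}" for k
  note gk = homeomorphic_mapsD(2)[OF homeomorphic_maps_funpow[OF hom]]
  have oII: "openin X (II k)" for k unfolding II_def using gk B(2) by (rule openin_continuous_map_preimage)
  have cBB: "closedin X (BB k)" for k unfolding BB_def using gk B(1) by (rule closedin_continuous_map_preimage)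
  have IB: "II k \<subseteq> BB k" for k unfolding II_def BB_def using B(4) by blast
  have BW: "BB k \<subseteq> ?Wu" for k
    unfolding BB_def using inv.stable_set_iff_iterate[OF SX gS] B(6) by blast
  have WI: "?Wu \<subseteq> (\<Union>k. II k)"
  proof
    fix x assume x: "x \<in> ?Wu"
    then obtain q where q: "x \<in> topspace X" "q \<in> S" "asymptotic d g q x" by (auto simp: stable_set_iff)
    obtain K where "\<And>k. k \<ge> K \<Longrightarrow> (g ^^ k) x \<in> I"
      using inv.asymptotic_eventually[OF q(1,2) _ _ B(2,3) q(3)] S(1) NN gS by blast
    then have "x \<in> II K" using q(1) unfolding II_def by blast
    then show "x \<in> (\<Union>k. II k)" by blast
  qed
  have Wu: "?Wu = (\<Union>k. II k)" using WI IB BW by blast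
  then show oW: "openin X ?Wu" using oII by auto
  have fA: "f ` A = A"
  proof -
    have iff: "g x \<in> ?Wu \<longleftrightarrow> x \<in> ?Wu" if "x \<in> topspace X" for x
      using inv.stable_set_iff_image[OF SX gS that] .
    have "f x \<in> A" if "x \<in> A" for x using iff[of "f x"] F that unfolding A_def by auto
    moreover have "x \<in> f ` A" if "x \<in> A" for x
    proof -
      have "g x \<in> A" using iff[of x] F that unfolding A_def by auto
      then show ?thesis using F(6)[of x] that unfolding A_def by (metis DiffD1 imageI)
    qed
    ultimately show ?thesis by blast
  qed
  have cA: "closedin X A" unfolding A_def using oW by blast
  have AS: "A \<inter> S = {}" unfolding A_def using inv.subset_stable_set[OF SX] by blast
  have finS: "finite S" using S(1) finite_N finite_subset by blast
  have per: "\<forall>x\<in>S. periodic_point f x"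
  proof
    fix x assume "x \<in> S"
    have "inj_on f S" using F(5) SX by (metis inj_on_inverseI subsetD)
    then show "periodic_point f x"
      using periodic_point_finite_invariant finS S(2) \<open>x \<in> S\<close> by (metis order_refl)
  qed
  \<comment> \<open>Points of \<open>N - S\<close> lie in the unstable set of \<open>N - S\<close>,
    which is disjoint from that of \<open>S\<close>.\<close>
  have NA: "N - S \<subseteq> A"
  proof -
    have "stable_set X d g (N - S) \<inter> ?Wu = {}"
      using inv.stable_set_disjoint[of "N - S" S] NN S(1) by blast
    moreover have "N - S \<subseteq> stable_set X d g (N - S)" using inv.subset_stable_set N_subset by blast
    ultimately show ?thesis unfolding A_def using N_subset by blast
  qed
  have perA: "\<forall>x\<in>topspace X. periodic_point f x \<longrightarrow> x \<in> A \<union> S"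
  proof (intro ballI impI)
    fix x assume x: "x \<in> topspace X" "periodic_point f x"
    then obtain k where k: "k \<ge> 1" "(f ^^ k) x = x" unfolding periodic_point_def by blast
    have "\<exists>k\<ge>1. (f ^^ k) ` U \<inter> U \<noteq> {}" if "openin X U \<and> x \<in> U" for U
    proof (intro exI conjI)
      have "(f ^^ k) x \<in> (f ^^ k) ` U" using that by blast
      then show "(f ^^ k) ` U \<inter> U \<noteq> {}" using k(2) that by auto
    qed (rule k(1))
    then have "x \<in> N" using x(1) unfolding nonwandering_def by simp
    then show "x \<in> A \<union> S" using NA by blast
  qed
  have trap: "\<exists>U. openin X U \<and> A \<subseteq> U \<and> U \<subseteq> G \<and> U \<inter> S = {} \<and> f ` U \<subseteq> U"
    if G: "openin X G" "A \<subseteq> G" for G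
  proof -
    have "closedin X (topspace X - G)" using G(1) by blast
    moreover have "topspace X - G \<subseteq> (\<Union>k. II k)" using G(2) Wu unfolding A_def by blast
    \<comment> \<open>The complement of \<open>G\<close> is compact and contained in the unstable
      set of \<open>S\<close>; monotonicity of \<open>BB\<close> reduces the finite cover to a
      single \<open>BB m\<close>.\<close>
    ultimately obtain m where m: "topspace X - G \<subseteq> (\<Union>k\<le>m. II k)"
      using compact_space_nat_cover[OF compact] oII by metis
    have "BB k \<subseteq> BB (Suc k)" for k unfolding BB_def using B(5) by auto
    then have "BB k \<subseteq> BB m" if "k \<le> m" for k using that lift_Suc_mono_le[of BB] by blast
    then have mB: "topspace X - G \<subseteq> BB m" using m IB by blast
    define U where "U = topspace X - BB m"
    have "openin X U" unfolding U_def using cBB by blast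
    moreover have "A \<subseteq> U" unfolding A_def U_def using BW by blast
    moreover have "U \<subseteq> G" unfolding U_def using mB by blast
    moreover have "U \<inter> S = {}"
    proof -
      have "(g ^^ m) x \<in> S" if "x \<in> S" for x using that gS by (intro funpow_in) auto
      then have "S \<subseteq> BB m" unfolding BB_def using B(3,4) SX by blast
      then show ?thesis unfolding U_def by blast
    qed
    moreover have "f x \<in> U" if x: "x \<in> U" for x
    proof -
      have xX: "x \<in> topspace X" using x unfolding U_def by blast
      have "(g ^^ m) (f x) \<notin> B"
      proof
        assume "(g ^^ m) (f x) \<in> B"
        then have "g ((g ^^ m) (f x)) \<in> B" using B(5) by blast
        then have "(g ^^ m) (g (f x)) \<in> B" by (simp add: funpow_swap1)
        then show False using x F(5)[OF xX] xX unfolding U_def BB_def by simp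
      qed
      then show ?thesis using F(3)[OF xX] unfolding U_def BB_def by blast
    qed
    ultimately show ?thesis by blast
  qed
  have absorb: "\<exists>k. (f ^^ k) x \<in> G"
    if G: "openin X G" "A \<subseteq> G" and x: "x \<in> topspace X - S" for G x
  proof -
    have xX: "x \<in> topspace X" using x by blast
    obtain q where q: "q \<in> N" "asymptotic d f q x" using asymptotic_exists[OF xX] .
    have "q \<notin> S"
    proof
      assume "q \<in> S"
      then have "x \<in> stable_set X d f S" using q(2) xX by (auto simp: stable_set_iff)
      then show False using st x by simp
    qed
    then have "q \<in> N - S" using q by blast
    moreover note complement_invariant[OF S]
    moreover have "N - S \<subseteq> G" using NA G(2) by blast
    ultimately obtain K where "\<And>k. k \<ge> K \<Longrightarrow> (f ^^ k) x \<in> G"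
      using asymptotic_eventually[OF xX _ _ _ G(1) _ q(2)] by blast
    then show ?thesis by blast
  qed
  have "\<forall>G. openin X G \<and> A \<subseteq> G \<longrightarrow>
      (\<exists>U. openin X U \<and> A \<subseteq> U \<and> U \<subseteq> G \<and> U \<inter> S = {} \<and> f ` U \<subseteq> U)"
    by (intro allI impI, elim conjE) (rule trap)
  moreover have "\<forall>G x. openin X G \<and> A \<subseteq> G \<and> x \<in> topspace X - S \<longrightarrow> (\<exists>k. (f ^^ k) x \<in> G)"
    by (intro allI impI, elim conjE) (rule absorb)
  ultimately show "attractor_dual_to X f (topspace X - ?Wu) S"
    unfolding attractor_dual_to_def A_def[symmetric]
    by (intro conjI cA fA finS SX S(2) AS per perA)
qed

end

text \<open>The unstable sets of the members of \<open>\<B>\<close> partition the space, and a sink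
  is its own unstable set. Thus the displayed union is the complement of the unstable set of the
  sources. The abstract \<open>\<B>\<close> and the pair \<open>f\<close>, \<open>g\<close> allow
  the use with time reversed, where \<open>src\<close> and \<open>snk\<close> change places.\<close>

lemma (in finite_nonwandering) attractor_of_decomposition:
  assumes pc: "connected_punctured_nbhds X"
    and \<B>: "\<Union>\<B> = N" "disjoint \<B>" "\<And>\<Lambda>. \<Lambda> \<in> \<B> \<Longrightarrow> \<Lambda> \<noteq> {} \<and> f ` \<Lambda> = \<Lambda>"
    and src: "src = {\<Lambda> \<in> \<B>. stable_set X d f \<Lambda> = \<Lambda>}"
    and snk: "snk = {\<Lambda> \<in> \<B>. stable_set X d g \<Lambda> = \<Lambda>}"
  shows "attractor_dual_to X f (\<Union>snk \<union> (\<Union>\<nu>\<in>\<B> - (snk \<union> src). stable_set X d g \<nu>)) (\<Union>src)"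
proof -
  interpret inv: finite_nonwandering X d g f by (rule reversed)
  have NN: "nonwandering X g = N" using nonwandering_inverse[OF hom] .
  have sub: "\<Lambda> \<subseteq> N" if "\<Lambda> \<in> \<B>" for \<Lambda> using that \<B>(1) by blast
  \<comment> \<open>A set that is both would be open, being the unstable set of a repeller, and
    finite, although non-empty open sets are infinite. Otherwise it would belong to the attractor
    and to its dual repeller.\<close>
  have not_both: "\<Lambda> \<notin> src" if "\<Lambda> \<in> snk" for \<Lambda>
  proof
    assume "\<Lambda> \<in> src"
    with that have L: "\<Lambda> \<in> \<B>" "stable_set X d f \<Lambda> = \<Lambda>" "stable_set X d g \<Lambda> = \<Lambda>"
      by (auto simp: src snk)
    have "openin X \<Lambda>"
      using repeller_attractor(1)[OF sub[OF L(1)] _ L(2)] \<B>(3)[OF L(1)] L(3) by simp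
    then have "infinite \<Lambda>"
      using connected_punctured_nbhds_infinite[OF pc Hausdorff] \<B>(3)[OF L(1)] by blast
    then show False using sub[OF L(1)] finite_N finite_subset by blast
  qed
  define S where "S = \<Union>src"
  have SN: "S \<subseteq> N" using sub unfolding S_def src by blast
  have "f ` S = \<Union>((`) f ` src)" unfolding S_def by blast
  also have "(`) f ` src = src" using \<B>(3) unfolding src by force
  finally have fS: "f ` S = S" unfolding S_def .
  have "stable_set X d f S = (\<Union>\<Lambda>\<in>src. stable_set X d f \<Lambda>)"
    unfolding S_def stable_set_def by blast
  also have "\<dots> = S" unfolding S_def src by auto
  finally have st: "stable_set X d f S = S" .
  have SX: "S \<subseteq> topspace X" using SN N_subset by blast
  let ?A = "\<Union>snk \<union> (\<Union>\<nu>\<in>\<B> - (snk \<union> src). stable_set X d g \<nu>)"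
  have "?A = (\<Union>\<Lambda>\<in>\<B> - src. stable_set X d g \<Lambda>)"
  proof -
    have "\<Union>snk = (\<Union>\<Lambda>\<in>snk. stable_set X d g \<Lambda>)" unfolding snk by auto
    moreover have "\<B> - src = snk \<union> (\<B> - (snk \<union> src))" using not_both unfolding snk by blast
    ultimately show ?thesis by auto
  qed
  also have "\<dots> = topspace X - stable_set X d g S"
  proof
    have "stable_set X d g \<Lambda> \<inter> stable_set X d g S = {}" if L: "\<Lambda> \<in> \<B> - src" for \<Lambda>
    proof (rule inv.stable_set_disjoint)
      show "\<Lambda> \<subseteq> nonwandering X g" "S \<subseteq> nonwandering X g" using sub L SN NN by auto
      show "\<Lambda> \<inter> S = {}"
      proof (rule ccontr)
        assume "\<Lambda> \<inter> S \<noteq> {}"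
        then obtain P where P: "P \<in> src" "\<Lambda> \<inter> P \<noteq> {}" unfolding S_def by blast
        then have "P = \<Lambda>" using disjointD[OF \<B>(2), of \<Lambda> P] L unfolding src by blast
        then show False using P L by blast
      qed
    qed
    moreover have "stable_set X d g \<Lambda> \<subseteq> topspace X" for \<Lambda> unfolding stable_set_def by blast
    ultimately show "(\<Union>\<Lambda>\<in>\<B> - src. stable_set X d g \<Lambda>) \<subseteq> topspace X - stable_set X d g S" by blast
    show "topspace X - stable_set X d g S \<subseteq> (\<Union>\<Lambda>\<in>\<B> - src. stable_set X d g \<Lambda>)"
    proof
      fix x assume x: "x \<in> topspace X - stable_set X d g S"
      then obtain q where q: "q \<in> N" "asymptotic d g q x"
        using inv.asymptotic_exists[of x] unfolding NN by blast
      then obtain \<Lambda> where L: "\<Lambda> \<in> \<B>" "q \<in> \<Lambda>" using \<B>(1) by blast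
      have "q \<notin> S"
      proof
        assume "q \<in> S"
        then have "x \<in> stable_set X d g S" using q(2) x by (auto simp: stable_set_iff)
        then show False using x by blast
      qed
      then have "\<Lambda> \<in> \<B> - src" using L unfolding S_def by blast
      moreover have "x \<in> stable_set X d g \<Lambda>" using q(2) L(2) x by (auto simp: stable_set_iff)
      ultimately show "x \<in> (\<Union>\<Lambda>\<in>\<B> - src. stable_set X d g \<Lambda>)" by blast
    qed
  qed
  finally show ?thesis using repeller_attractor(2)[OF SN fS st] by (simp add: S_def)
qed

lemma attractor_dual_toD:
  assumes "attractor_dual_to X f A S"
  shows "closedin X A" "f ` A = A"
  using assms unfolding attractor_dual_to_def by simp_all

section \<open>Basic sets of a regular homeomorphism\<close>

lemma spectral_decomposition_basic_sets:
  assumes "homeomorphic_map X X f" "basic_sets X f \<noteq> {}"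
  shows "spectral_decomposition X f (basic_sets X f)"
proof -
  obtain \<B> where \<B>: "spectral_decomposition X f \<B>" using assms(2) unfolding basic_sets_def by blast
  \<comment> \<open>\<open>basic_sets\<close> pools the members of all decompositions; by uniqueness
    there is only one.\<close>
  have "basic_sets X f = \<B>"
    using spectral_decomposition_unique[OF assms(1) \<B>] \<B> unfolding basic_sets_def by blast
  then show ?thesis using \<B> by simp
qed

lemma finite_range_funpow_periodic:
  assumes "(f ^^ k) p = p" "k \<ge> 1"
  shows "finite (range (\<lambda>j. (f ^^ j) p))"
proof -
  have "(f ^^ j) p = (f ^^ (j mod k)) p" for j using funpow_mod_eq[OF assms(1)] by simp
  moreover have "j mod k < k" for j using assms(2) by simp
  ultimately have "range (\<lambda>j. (f ^^ j) p) \<subseteq> (\<lambda>j. (f ^^ j) p) ` {..<k}" by blast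
  then show ?thesis using finite_subset by blast
qed

lemma trivial_basic_set_finite:
  assumes "homeomorphic_map X X f" "trivial_basic_set X f \<Lambda>"
  shows "finite \<Lambda>"
proof -
  obtain p k where p: "p \<in> topspace X" "k \<ge> 1" "(f ^^ k) p = p" "\<Lambda> = orbit_of X f p"
    using assms(2) unfolding trivial_basic_set_def periodic_point_def by blast
  have "(inv_on X f ^^ k) p = p"
    using homeomorphic_mapsD(5)[OF homeomorphic_maps_funpow[OF homeomorphic_maps_inv_on[OF assms(1)]] p(1), of k]
      p(3) by simp
  then show ?thesis using p finite_range_funpow_periodic unfolding orbit_of_def by (metis finite_UnI)
qed

lemma unstable_set_eq: "unstable_set X d f \<Lambda> = stable_set X d (inv_on X f) \<Lambda>"
  by (simp add: unstable_set_def stable_set_def)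

lemma SRH_homeomorphic_map: "f \<in> SRH n X d \<Longrightarrow> homeomorphic_map X X f"
  by (simp add: SRH_def Smale_A_homeomorphism_def)

context
  fixes X :: "'a topology" and d and f :: "'a \<Rightarrow> 'a"
  assumes metric: "metric_on X d" and compact: "compact_space X"
    and pc: "connected_punctured_nbhds X"
    and hom: "homeomorphic_map X X f" and reg: "regular X d f"
    and saddle: "saddle_periodic_points X d f \<noteq> {}"
begin

text \<open>Regularity quantifies over basic sets; that a decomposition exists is read off from the
  saddle periodic point, which lies in some basic set.\<close>

lemma regular_spectral_decomposition: "spectral_decomposition X f (basic_sets X f)"
proof -
  have "basic_sets X f \<noteq> {}"
    using saddle unfolding saddle_periodic_points_def saddle_basic_sets_def by blast
  then show ?thesis using hom spectral_decomposition_basic_sets by blast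
qed

text \<open>Sinks, sources and saddles exhaust the basic sets, so regularity makes each of the
  finitely many basic sets a periodic orbit.\<close>

lemma regular_finite_nonwandering: "finite_nonwandering X d f (inv_on X f)"
proof -
  note sd = regular_spectral_decomposition
  have "finite \<Lambda>" if "\<Lambda> \<in> basic_sets X f" for \<Lambda>
    using that reg hom trivial_basic_set_finite unfolding regular_def saddle_basic_sets_def by blast
  moreover have "finite (basic_sets X f)" "\<Union>(basic_sets X f) = nonwandering X f"
    using sd unfolding spectral_decomposition_def by auto
  ultimately have "finite (nonwandering X f)" by (metis finite_Union)
  then show ?thesis
    using metric compact homeomorphic_maps_inv_on[OF hom] by (simp add: finite_nonwandering_def)
qed

lemma A_set_attractor: "attractor_dual_to X f (A_set X d f) (\<Union>(source_basic_sets X d f))"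
proof -
  interpret finite_nonwandering X d f "inv_on X f" by (rule regular_finite_nonwandering)
  show ?thesis
    unfolding A_set_def saddle_basic_sets_def unstable_set_eq
  proof (rule attractor_of_decomposition[OF pc])
    show "\<Union>(basic_sets X f) = nonwandering X f" "disjoint (basic_sets X f)"
      "\<And>\<Lambda>. \<Lambda> \<in> basic_sets X f \<Longrightarrow> \<Lambda> \<noteq> {} \<and> f ` \<Lambda> = \<Lambda>"
      using regular_spectral_decomposition unfolding spectral_decomposition_def by auto
  qed (simp_all add: source_basic_sets_def sink_basic_sets_def unstable_set_eq)
qed

text \<open>Time reversal exchanges sinks with sources and stable with unstable sets. The
  decomposition remains that of \<open>f\<close>, whose members are also invariant under the
  inverse.\<close>

lemma R_set_attractor_inverse:
  "attractor_dual_to X (inv_on X f) (R_set X d f) (\<Union>(sink_basic_sets X d f))"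
proof -
  interpret fn: finite_nonwandering X d f "inv_on X f" by (rule regular_finite_nonwandering)
  interpret finite_nonwandering X d "inv_on X f" f by (rule fn.reversed)
  have sd: "\<Union>(basic_sets X f) = nonwandering X f" "disjoint (basic_sets X f)"
      "\<And>\<Lambda>. \<Lambda> \<in> basic_sets X f \<Longrightarrow> \<Lambda> \<noteq> {} \<and> \<Lambda> \<subseteq> topspace X \<and> f ` \<Lambda> = \<Lambda>"
    using regular_spectral_decomposition closedin_subset unfolding spectral_decomposition_def by auto
  show ?thesis
    unfolding R_set_def saddle_basic_sets_def Un_commute[of "sink_basic_sets X d f"]
  proof (rule attractor_of_decomposition[OF pc _ sd(2)])
    show "\<Union>(basic_sets X f) = nonwandering X (inv_on X f)"
      using sd(1) nonwandering_inverse[OF fn.hom] by simp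
    show "\<Lambda> \<noteq> {} \<and> inv_on X f ` \<Lambda> = \<Lambda>" if "\<Lambda> \<in> basic_sets X f" for \<Lambda>
      using sd(3)[OF that] homeomorphic_maps_invariant_swap[OF fn.hom] by blast
  qed (simp_all add: source_basic_sets_def sink_basic_sets_def unstable_set_eq)
qed

end

section \<open>Invariance under conjugacy\<close>

lemma compact_metric_uniformly_continuous:
  assumes "metric_on X d" "compact_space X" "continuous_map X X h" "e > 0"
  obtains r where "r > 0"
    "\<And>x y. x \<in> topspace X \<Longrightarrow> y \<in> topspace X \<Longrightarrow> d x y < r \<Longrightarrow> d (h x) (h y) < e"
proof -
  interpret Metric_space "topspace X" d using assms(1) by (simp add: metric_on_def)
  let ?m = "metric (topspace X, d)"
  have m: "mtopology = X" using assms(1) by (simp add: metric_on_def)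
  have "uniformly_continuous_map ?m ?m h"
    using assms(2,3) by (intro continuous_imp_uniformly_continuous_map) (simp add: m)
  then show ?thesis
    using assms(4) that unfolding uniformly_continuous_map_def by simp blast
qed

text \<open>A conjugacy need not respect the metric, but on a compact space it is uniformly
  continuous, which is enough to keep distances tending to zero.\<close>

lemma asymptotic_conjugate:
  assumes "metric_on X d" "compact_space X" "continuous_map X X h"
    and f1: "f1 ` topspace X \<subseteq> topspace X" and eq: "\<And>x. x \<in> topspace X \<Longrightarrow> h (f1 x) = f2 (h x)"
    and xy: "x \<in> topspace X" "y \<in> topspace X" "asymptotic d f1 x y"
  shows "asymptotic d f2 (h x) (h y)"
  unfolding asymptotic_def
proof (rule LIMSEQ_I)
  fix e :: real
  assume "0 < e"
  then obtain r where r: "r > 0"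
      "\<And>x y. x \<in> topspace X \<Longrightarrow> y \<in> topspace X \<Longrightarrow> d x y < r \<Longrightarrow> d (h x) (h y) < e"
    using compact_metric_uniformly_continuous[OF assms(1-3)] by metis
  interpret Metric_space "topspace X" d using assms(1) by (simp add: metric_on_def)
  obtain K where K: "\<And>k. k \<ge> K \<Longrightarrow> norm (d ((f1 ^^ k) x) ((f1 ^^ k) y) - 0) < r"
    using LIMSEQ_D[OF xy(3)[unfolded asymptotic_def] r(1)] by blast
  have X: "(f1 ^^ k) z \<in> topspace X" if "z \<in> topspace X" for z k
    using f1 that by (intro funpow_in) auto
  have it: "(f2 ^^ k) (h z) = h ((f1 ^^ k) z)" if "z \<in> topspace X" for z k
    by (rule conjugacy_iterate[where h = h and ?f2.0 = f2, OF f1 _ that, symmetric]) (rule eq)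
  have "norm (d ((f2 ^^ k) (h x)) ((f2 ^^ k) (h y)) - 0) < e" if "k \<ge> K" for k
    using r(2)[OF X[OF xy(1)] X[OF xy(2)], of k k] K[OF that] it[OF xy(1)] it[OF xy(2)]
    by simp
  then show "\<exists>no. \<forall>k\<ge>no. norm (d ((f2 ^^ k) (h x)) ((f2 ^^ k) (h y)) - 0) < e" by blast
qed

lemma stable_set_conjugate_subset:
  assumes "metric_on X d" "compact_space X" "continuous_map X X h"
    and "f1 ` topspace X \<subseteq> topspace X" "\<And>x. x \<in> topspace X \<Longrightarrow> h (f1 x) = f2 (h x)"
    and P: "P \<subseteq> topspace X"
  shows "h ` stable_set X d f1 P \<subseteq> stable_set X d f2 (h ` P)"
proof (rule image_subsetI)
  have hX: "h x \<in> topspace X" if "x \<in> topspace X" for x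
    using assms(3) that by (auto simp: continuous_map_def)
  fix y assume "y \<in> stable_set X d f1 P"
  then obtain x where "y \<in> topspace X" "x \<in> P" "asymptotic d f1 x y" by (auto simp: stable_set_iff)
  then show "h y \<in> stable_set X d f2 (h ` P)"
    using asymptotic_conjugate[where h = h and ?f2.0 = f2, OF assms(1-5), of x y] hX P by (auto simp: stable_set_iff)
qed

lemma conjugate_inverse:
  assumes "homeomorphic_maps X X f1 g1" "homeomorphic_maps X X f2 g2"
    and "h ` topspace X \<subseteq> topspace X" "\<And>x. x \<in> topspace X \<Longrightarrow> h (f1 x) = f2 (h x)" "x \<in> topspace X"
  shows "h (g1 x) = g2 (h x)"
proof -
  have g1x: "g1 x \<in> topspace X" using homeomorphic_mapsD(4)[OF assms(1,5)] .
  have "g2 (h x) = g2 (h (f1 (g1 x)))" using homeomorphic_mapsD(6)[OF assms(1,5)] by simp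
  also have "\<dots> = g2 (f2 (h (g1 x)))" using assms(4)[OF g1x] by simp
  also have "\<dots> = h (g1 x)" using homeomorphic_mapsD(5)[OF assms(2)] assms(3) g1x by blast
  finally show ?thesis by simp
qed

text \<open>With the inverse \<open>k\<close> as a parameter the two systems can be exchanged
  (\<open>reversed\<close>), which upgrades inclusions to equalities. Passing to the inverses of
  \<open>f1\<close> and \<open>f2\<close> with the same \<open>h\<close> transfers results from
  stable to unstable sets.\<close>

locale conjugate_systems =
  fixes X :: "'a topology" and d :: "'a \<Rightarrow> 'a \<Rightarrow> real" and f1 f2 h k :: "'a \<Rightarrow> 'a"
  assumes metric: "metric_on X d" and compact: "compact_space X"
    and f1: "homeomorphic_map X X f1" and f2: "homeomorphic_map X X f2"
    and h: "homeomorphic_maps X X h k" and eq: "\<And>x. x \<in> topspace X \<Longrightarrow> h (f1 x) = f2 (h x)"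
begin

lemmas F1 = homeomorphic_mapsD[OF homeomorphic_maps_inv_on[OF f1]]
lemmas F2 = homeomorphic_mapsD[OF homeomorphic_maps_inv_on[OF f2]]
lemmas H = homeomorphic_mapsD[OF h]

lemma eq': "x \<in> topspace X \<Longrightarrow> k (f2 x) = f1 (k x)"
  using eq[of "k x"] F1(3) H by metis

lemma reversed: "conjugate_systems X d f2 f1 k h"
  using metric compact f1 f2 h homeomorphic_maps_sym eq' by (auto simp: conjugate_systems_def)

lemma eq_inv: "x \<in> topspace X \<Longrightarrow> h (inv_on X f1 x) = inv_on X f2 (h x)"
  using H(3)
  by (intro conjugate_inverse[where h = h, OF homeomorphic_maps_inv_on[OF f1] homeomorphic_maps_inv_on[OF f2]] eq)
    auto

lemma image_inverse: "S \<subseteq> topspace X \<Longrightarrow> k ` h ` S = S"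
  using H(5) by (force simp: image_image)

lemma image_inverse': "S \<subseteq> topspace X \<Longrightarrow> h ` k ` S = S"
  using H(6) by (force simp: image_image)

lemma stable_set_image:
  assumes "P \<subseteq> topspace X"
  shows "stable_set X d f2 (h ` P) = h ` stable_set X d f1 P"
proof
  have "k ` stable_set X d f2 (h ` P) \<subseteq> stable_set X d f1 (k ` h ` P)"
    using F2(3) H(3) assms
    by (intro stable_set_conjugate_subset[where ?f2.0 = f1, OF metric compact H(2)] eq') auto
  then have "h ` k ` stable_set X d f2 (h ` P) \<subseteq> h ` stable_set X d f1 P"
    using image_inverse[OF assms] by (metis image_mono)
  moreover have "stable_set X d f2 (h ` P) \<subseteq> topspace X" by (auto simp: stable_set_def)
  ultimately show "stable_set X d f2 (h ` P) \<subseteq> h ` stable_set X d f1 P"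
    using image_inverse' by simp
  show "h ` stable_set X d f1 P \<subseteq> stable_set X d f2 (h ` P)"
    using F1(3)
    by (intro stable_set_conjugate_subset[where ?f2.0 = f2, OF metric compact H(1)] eq assms) auto
qed

lemma unstable_set_image:
  assumes "P \<subseteq> topspace X"
  shows "unstable_set X d f2 (h ` P) = h ` unstable_set X d f1 P"
proof -
  have "homeomorphic_map X X (inv_on X f1)" "homeomorphic_map X X (inv_on X f2)"
    using homeomorphic_maps_inv_on f1 f2 homeomorphic_maps_sym homeomorphic_maps_imp_map by blast+
  then interpret inv: conjugate_systems X d "inv_on X f1" "inv_on X f2" h k
    using metric compact h eq_inv by (simp add: conjugate_systems_def)
  show ?thesis unfolding unstable_set_eq using inv.stable_set_image[OF assms] .
qed

lemma iterate_image: "x \<in> topspace X \<Longrightarrow> h ((f1 ^^ n) x) = (f2 ^^ n) (h x)"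
  using F1(3) by (intro conjugacy_iterate[where h = h and U = "topspace X"] eq) auto

lemma iterate_inv_image: "x \<in> topspace X \<Longrightarrow> h ((inv_on X f1 ^^ n) x) = (inv_on X f2 ^^ n) (h x)"
  using F1(4) by (intro conjugacy_iterate[where h = h and U = "topspace X"] eq_inv) auto

lemma nonwandering_image_subset: "h ` nonwandering X f1 \<subseteq> nonwandering X f2"
proof (rule image_subsetI)
  fix x assume x: "x \<in> nonwandering X f1"
  then have xX: "x \<in> topspace X" by (simp add: nonwandering_def)
  have "\<exists>n\<ge>1. (f2 ^^ n) ` U \<inter> U \<noteq> {}" if U: "openin X U \<and> h x \<in> U" for U
  proof -
    have "openin X {y \<in> topspace X. h y \<in> U}" using H(1) U openin_continuous_map_preimage by blast
    moreover have "x \<in> {y \<in> topspace X. h y \<in> U}" using U xX by blast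
    ultimately obtain n where n: "n \<ge> 1"
        "(f1 ^^ n) ` {y \<in> topspace X. h y \<in> U} \<inter> {y \<in> topspace X. h y \<in> U} \<noteq> {}"
      using x unfolding nonwandering_def by blast
    then obtain y where y: "y \<in> topspace X" "h y \<in> U" "h ((f1 ^^ n) y) \<in> U" by blast
    then have "(f2 ^^ n) (h y) \<in> (f2 ^^ n) ` U \<inter> U" using iterate_image[OF y(1)] by simp
    then show ?thesis using n(1) by blast
  qed
  then show "h x \<in> nonwandering X f2" using H(3)[OF xX] unfolding nonwandering_def by simp
qed

lemma nonwandering_image: "h ` nonwandering X f1 = nonwandering X f2"
proof
  interpret r: conjugate_systems X d f2 f1 k h by (rule reversed)
  have "h ` k ` nonwandering X f2 \<subseteq> h ` nonwandering X f1"
    using r.nonwandering_image_subset by (rule image_mono)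
  moreover have "nonwandering X f2 \<subseteq> topspace X" by (auto simp: nonwandering_def)
  ultimately show "nonwandering X f2 \<subseteq> h ` nonwandering X f1" using image_inverse' by simp
qed (rule nonwandering_image_subset)

lemma orbit_image: "x \<in> topspace X \<Longrightarrow> h ` orbit_of X f1 x = orbit_of X f2 (h x)"
  by (simp add: orbit_of_def image_Un image_image iterate_image iterate_inv_image)

lemma closure_image: "S \<subseteq> topspace X \<Longrightarrow> X closure_of (h ` S) = h ` (X closure_of S)"
  using homeomorphic_map_closure_of[OF homeomorphic_maps_imp_map[OF h]] by blast

lemma spectral_decomposition_image:
  assumes "spectral_decomposition X f1 \<B>"
  shows "spectral_decomposition X f2 ((`) h ` \<B>)"
proof -
  have \<B>: "finite \<B>" "disjoint \<B>" "\<Union>\<B> = nonwandering X f1"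
    and L: "\<And>\<Lambda>. \<Lambda> \<in> \<B> \<Longrightarrow> \<Lambda> \<noteq> {} \<and> closedin X \<Lambda> \<and> f1 ` \<Lambda> = \<Lambda> \<and> topologically_transitive X f1 \<Lambda>"
    using assms by (auto simp: spectral_decomposition_def)
  have LX: "\<Lambda> \<subseteq> topspace X" if "\<Lambda> \<in> \<B>" for \<Lambda> using L[OF that] closedin_subset by blast
  have "disjoint ((`) h ` \<B>)"
  proof (rule disjointI)
    fix P Q assume "P \<in> (`) h ` \<B>" "Q \<in> (`) h ` \<B>" "P \<noteq> Q"
    then obtain A B where AB: "A \<in> \<B>" "B \<in> \<B>" "P = h ` A" "Q = h ` B" "A \<noteq> B" by blast
    then have "A \<inter> B = {}" using disjointD[OF \<B>(2)] by blast
    moreover have "inj_on h (topspace X)" using H(5) by (metis inj_on_inverseI)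
    ultimately show "P \<inter> Q = {}" using AB LX by (metis image_empty inj_on_image_Int)
  qed
  moreover have "\<Union>((`) h ` \<B>) = nonwandering X f2"
    unfolding image_Union[symmetric] \<B>(3) by (rule nonwandering_image)
  moreover have "h ` \<Lambda> \<noteq> {} \<and> closedin X (h ` \<Lambda>) \<and> f2 ` h ` \<Lambda> = h ` \<Lambda> \<and>
      topologically_transitive X f2 (h ` \<Lambda>)" if l: "\<Lambda> \<in> \<B>" for \<Lambda>
  proof (intro conjI)
    show "h ` \<Lambda> \<noteq> {}" using L[OF l] by blast
    show "closedin X (h ` \<Lambda>)"
      using L[OF l] homeomorphic_map_closedness_eq[OF homeomorphic_maps_imp_map[OF h]] by blast
    have "f2 ` h ` \<Lambda> = h ` f1 ` \<Lambda>" using eq LX[OF l] by (force simp: image_image)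
    then show "f2 ` h ` \<Lambda> = h ` \<Lambda>" using L[OF l] by simp
    obtain x where x: "x \<in> \<Lambda>" "\<Lambda> \<subseteq> X closure_of (orbit_of X f1 x)"
      using L[OF l] unfolding topologically_transitive_def by blast
    have xX: "x \<in> topspace X" using x(1) LX[OF l] by blast
    have "inj_on f1 (topspace X)" using F1(5) by (metis inj_on_inverseI)
    then have "orbit_of X f1 x \<subseteq> \<Lambda>" using orbit_of_subset LX[OF l] L[OF l] x(1) by metis
    then have "orbit_of X f1 x \<subseteq> topspace X" using LX[OF l] by blast
    then have "h ` \<Lambda> \<subseteq> X closure_of (orbit_of X f2 (h x))"
      using closure_image orbit_image[OF xX] x(2) by (metis image_mono)
    then show "topologically_transitive X f2 (h ` \<Lambda>)"
      unfolding topologically_transitive_def using x(1) by blast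
  qed
  ultimately show ?thesis using \<B>(1) by (auto simp: spectral_decomposition_def)
qed

lemma basic_sets_image: "basic_sets X f2 = (`) h ` basic_sets X f1"
proof
  interpret r: conjugate_systems X d f2 f1 k h by (rule reversed)
  show "(`) h ` basic_sets X f1 \<subseteq> basic_sets X f2"
    using spectral_decomposition_image unfolding basic_sets_def by blast
  show "basic_sets X f2 \<subseteq> (`) h ` basic_sets X f1"
  proof
    fix \<Lambda> assume "\<Lambda> \<in> basic_sets X f2"
    then obtain \<B> where \<B>: "spectral_decomposition X f2 \<B>" "\<Lambda> \<in> \<B>" unfolding basic_sets_def by blast
    then have "\<Lambda> \<subseteq> topspace X" using closedin_subset unfolding spectral_decomposition_def by blast
    then have "\<Lambda> = h ` k ` \<Lambda>" using image_inverse' by simp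
    moreover have "k ` \<Lambda> \<in> basic_sets X f1"
      using r.spectral_decomposition_image[OF \<B>(1)] \<B>(2) unfolding basic_sets_def by blast
    ultimately show "\<Lambda> \<in> (`) h ` basic_sets X f1" by blast
  qed
qed

lemma A_set_image: "A_set X d f2 = h ` A_set X d f1"
proof -
  have BX: "\<Lambda> \<subseteq> topspace X" if "\<Lambda> \<in> basic_sets X f1" for \<Lambda>
    using that closedin_subset unfolding basic_sets_def spectral_decomposition_def by blast
  have img: "h ` P = h ` Q \<longleftrightarrow> P = Q" if "P \<subseteq> topspace X" "Q \<subseteq> topspace X" for P Q
    using image_inverse that by metis
  have u: "unstable_set X d f2 (h ` \<Lambda>) = h ` \<Lambda> \<longleftrightarrow> unstable_set X d f1 \<Lambda> = \<Lambda>"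
    "stable_set X d f2 (h ` \<Lambda>) = h ` \<Lambda> \<longleftrightarrow> stable_set X d f1 \<Lambda> = \<Lambda>"
    if "\<Lambda> \<in> basic_sets X f1" for \<Lambda>
  proof -
    have "unstable_set X d f1 \<Lambda> \<subseteq> topspace X" "stable_set X d f1 \<Lambda> \<subseteq> topspace X"
      by (auto simp: unstable_set_def stable_set_def)
    then show "unstable_set X d f2 (h ` \<Lambda>) = h ` \<Lambda> \<longleftrightarrow> unstable_set X d f1 \<Lambda> = \<Lambda>"
      "stable_set X d f2 (h ` \<Lambda>) = h ` \<Lambda> \<longleftrightarrow> stable_set X d f1 \<Lambda> = \<Lambda>"
      using unstable_set_image stable_set_image img BX[OF that] by simp_all
  qed
  have sink: "sink_basic_sets X d f2 = (`) h ` sink_basic_sets X d f1"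
    using u(1) unfolding sink_basic_sets_def basic_sets_image by blast
  have source: "source_basic_sets X d f2 = (`) h ` source_basic_sets X d f1"
    using u(2) unfolding source_basic_sets_def basic_sets_image by blast
  \<comment> \<open>Saddles are defined as a set difference, and images commute with differences
    only under injectivity.\<close>
  have "inj_on ((`) h) (basic_sets X f1)" using img BX by (auto simp: inj_on_def)
  then have "saddle_basic_sets X d f2 = (`) h ` saddle_basic_sets X d f1"
    unfolding saddle_basic_sets_def sink source basic_sets_image image_Un[symmetric]
    by (rule inj_on_image_set_diff[symmetric]) (auto simp: sink_basic_sets_def source_basic_sets_def)
  moreover have "unstable_set X d f2 (h ` \<nu>) = h ` unstable_set X d f1 \<nu>"
    if "\<nu> \<in> saddle_basic_sets X d f1" for \<nu>
    using that BX unstable_set_image unfolding saddle_basic_sets_def by blast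
  ultimately show ?thesis
    unfolding A_set_def image_Un image_UN image_Union sink by simp
qed

text \<open>A global conjugacy is its own witness, with the whole space as both
  neighbourhoods.\<close>

lemma same_dynamical_embedding_image:
  assumes "A \<subseteq> topspace X" "f1 ` A = A" "f2 ` h ` A = h ` A"
  shows "same_dynamical_embedding X f1 A X f2 (h ` A)"
proof -
  have hX: "h ` topspace X = topspace X" using H(3,4,6) by force
  have sub: "topspace X \<union> f1 ` topspace X = topspace X" using F1(3) by blast
  have nb: "neighbourhood_of X (topspace X) (X closure_of S)" for S
    unfolding neighbourhood_of_def
    by (intro conjI exI[of _ "topspace X"] closure_of_subset_topspace openin_topspace order_refl)
  have hA: "h ` A \<subseteq> topspace X" using assms(1) hX by blast
  have "embedding_map (subtopology X (topspace X \<union> f1 ` topspace X)) X h"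
    using homeomorphic_maps_imp_map[OF h] unfolding embedding_map_def sub by (simp add: hX)
  then show ?thesis
    unfolding same_dynamical_embedding_def
    by (intro conjI exI[of _ "topspace X"] exI[of _ h] ballI assms nb hX hA eq
      closure_image[OF assms(1), symmetric])
qed

end

section \<open>The classification\<close>

theorem corollary1:
  fixes M :: "'a topology" and \<rho> :: "'a \<Rightarrow> 'a \<Rightarrow> real" and f1 f2 :: "'a \<Rightarrow> 'a"
  assumes "CARD('n::finite) \<ge> 2"
    and "closed_manifold TYPE('n) M"
    and "metric_on M \<rho>"
    and "f1 \<in> SRH TYPE('n) M \<rho>" and "f2 \<in> SRH TYPE('n) M \<rho>"
    and "saddle_periodic_points M \<rho> f1 \<noteq> {}" and "saddle_periodic_points M \<rho> f2 \<noteq> {}"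
  shows "conjugate M f1 f2 \<longleftrightarrow>
           same_dynamical_embedding M f1 (A_set M \<rho> f1) M f2 (A_set M \<rho> f2) \<or>
           same_dynamical_embedding M f1 (R_set M \<rho> f1) M f2 (R_set M \<rho> f2)"
proof -
  have M: "topological_manifold TYPE('n) M" "compact_space M"
    using assms(2) by (auto simp: closed_manifold_def)
  have pc: "connected_punctured_nbhds M"
    using manifold_connected_punctured_nbhds[OF M(1) assms(1)] .
  have Haus: "Hausdorff_space M" using M(1) by (simp add: topological_manifold_def)
  have f1: "homeomorphic_map M M f1" "regular M \<rho> f1" and f2: "homeomorphic_map M M f2" "regular M \<rho> f2"
    using assms(4,5) SRH_homeomorphic_map by (auto simp: SRH_def)
  note hom1 = homeomorphic_maps_inv_on[OF f1(1)] and hom2 = homeomorphic_maps_inv_on[OF f2(1)]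
  note A1 = A_set_attractor[OF assms(3) M(2) pc f1 assms(6)]
    and A2 = A_set_attractor[OF assms(3) M(2) pc f2 assms(7)]
    and R1 = R_set_attractor_inverse[OF assms(3) M(2) pc f1 assms(6)]
    and R2 = R_set_attractor_inverse[OF assms(3) M(2) pc f2 assms(7)]
  show ?thesis
  proof (intro iffI; (elim disjE)?)
    assume "conjugate M f1 f2"
    then obtain h k where "homeomorphic_maps M M h k" "\<forall>x\<in>topspace M. h (f1 x) = f2 (h x)"
      unfolding conjugate_def homeomorphic_map_maps by blast
    then interpret conjugate_systems M \<rho> f1 f2 h k
      using assms(3) M(2) f1(1) f2(1) by (simp add: conjugate_systems_def)
    have "same_dynamical_embedding M f1 (A_set M \<rho> f1) M f2 (A_set M \<rho> f2)"
      unfolding A_set_image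
    proof (rule same_dynamical_embedding_image)
      show "A_set M \<rho> f1 \<subseteq> topspace M" "f1 ` A_set M \<rho> f1 = A_set M \<rho> f1"
        using attractor_dual_toD[OF A1] closedin_subset by blast+
      show "f2 ` h ` A_set M \<rho> f1 = h ` A_set M \<rho> f1"
        using attractor_dual_toD(2)[OF A2] unfolding A_set_image .
    qed
    then show "same_dynamical_embedding M f1 (A_set M \<rho> f1) M f2 (A_set M \<rho> f2) \<or>
        same_dynamical_embedding M f1 (R_set M \<rho> f1) M f2 (R_set M \<rho> f2)" ..
  next
    assume emb: "same_dynamical_embedding M f1 (A_set M \<rho> f1) M f2 (A_set M \<rho> f2)"
    from same_dynamical_embedding_germ[OF emb attractor_dual_toD(1)[OF A1] attractor_dual_toD(1)[OF A2]] obtain G1 G2 h h' where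
      G: "openin M G1" "A_set M \<rho> f1 \<subseteq> G1" "openin M G2"
        "homeomorphic_maps (subtopology M G1) (subtopology M G2) h h'"
        "h ` A_set M \<rho> f1 = A_set M \<rho> f2"
        "\<And>x. x \<in> G1 \<Longrightarrow> h (f1 x) = f2 (h x)"
      by metis
    obtain H where "homeomorphic_map M M H" "\<And>x. x \<in> topspace M \<Longrightarrow> H (f1 x) = f2 (H x)"
      using conjugacy_from_germ[OF M(2) Haus pc hom1 hom2 A1 A2 G] by metis
    then show "conjugate M f1 f2" unfolding conjugate_def by blast
  next
    assume emb: "same_dynamical_embedding M f1 (R_set M \<rho> f1) M f2 (R_set M \<rho> f2)"
    from same_dynamical_embedding_germ[OF emb attractor_dual_toD(1)[OF R1] attractor_dual_toD(1)[OF R2]] obtain G1 G2 h h' where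
      G: "openin M G1" "R_set M \<rho> f1 \<subseteq> G1" "openin M G2"
        "homeomorphic_maps (subtopology M G1) (subtopology M G2) h h'"
        "h ` R_set M \<rho> f1 = R_set M \<rho> f2"
        and eq: "\<And>x. x \<in> G1 \<Longrightarrow> h (f1 x) = f2 (h x)"
      by metis
    have GM: "G1 \<subseteq> topspace M" using G(1) openin_subset by blast
    have eq': "h (inv_on M f1 x) = inv_on M f2 (h x)" if x: "x \<in> G1" "inv_on M f1 x \<in> G1" for x
    proof -
      have "h (inv_on M f1 x) \<in> topspace M"
        using homeomorphic_mapsD(3)[OF G(4), of "inv_on M f1 x"] x(2) GM by auto
      then have "inv_on M f2 (f2 (h (inv_on M f1 x))) = h (inv_on M f1 x)"
        using homeomorphic_mapsD(5)[OF hom2] by blast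
      moreover have "f1 (inv_on M f1 x) = x" using homeomorphic_mapsD(6)[OF hom1] x(1) GM by blast
      ultimately show ?thesis using eq[OF x(2)] by simp
    qed
    note inv1 = hom1[THEN homeomorphic_maps_sym[THEN iffD1]]
      and inv2 = hom2[THEN homeomorphic_maps_sym[THEN iffD1]]
    obtain H where H: "homeomorphic_map M M H"
        "\<And>x. x \<in> topspace M \<Longrightarrow> H (inv_on M f1 x) = inv_on M f2 (H x)"
      using conjugacy_from_germ[OF M(2) Haus pc inv1 inv2 R1 R2 G eq'] by metis
    have "H ` topspace M \<subseteq> topspace M"
      using H(1) homeomorphic_imp_surjective_map by blast
    \<comment> \<open>\<open>H\<close> conjugates the inverses; inverting once more returns to
      \<open>f1\<close> and \<open>f2\<close>.\<close>
    then have "H (f1 x) = f2 (H x)" if "x \<in> topspace M" for x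
      using conjugate_inverse[where h = H, OF inv1 inv2 _ _ that] H(2) by blast
    then show "conjugate M f1 f2" using H(1) unfolding conjugate_def by blast
  qed
qed

end
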